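(* Let $n$ be a positive integer and let $a,b,c$ be real numbers. Let $\mathbf{H}_{n+2}$, $\lambda_k$, $\theta_k$ ($k=0,1,\ldots,n+1$), $F_m(t;\alpha,\beta)$ and $G_m(t;\alpha,\beta)$ be as defined in the context. (a) If $n$ is odd, then the eigenvalues of $\mathbf{H}_{n+2}$ that are not of the form $\lambda_0$, $|\lambda_k|$, $-|\lambda_k|$, $k=1,\ldots,\frac{n+1}{2}$, are precisely the zeros of the function $$f(t) = 1 + \frac{a}{n+2} F_{\frac{n+1}{2}}\left(t;\frac{2\pi}{n+2},\frac{2\pi}{n+2}\right) + \frac{b}{n+2} F_{\frac{n+1}{2}}(t;0,0) + \frac{ab}{(n+2)^2} F_{\frac{n+1}{2}}\left(t;\frac{2\pi}{n+2},\frac{2\pi}{n+2}\right) F_{\frac{n+1}{2}}(t;0,0) - \frac{ab}{(n+2)^2} \left[F_{\frac{n+1}{2}}\left(t;0,\frac{2\pi}{n+2}\right)\right]^2 .$$ Moreover, if $\mu_1 \leqslant \mu_2 \leqslant \cdots \leqslant \mu_{n+2}$ are the eigenvalues of $\mathbf{H}_{n+2}$ and the $n+2$ numbers $\lambda_0$, $|\lambda_k|$, $-|\lambda_k|$, $k=1,\ldots,\frac{n+1}{2}$, are arranged in non-decreasing order as $d_1 \leqslant d_2 \leqslant \cdots \leqslant d_{n+2}$, then $$d_k + \min\{0,-a,-b\} \leqslant \mu_k \leqslant d_k + \max\{0,-a,-b\}, \quad k=1,\ldots,n+2.$$ (b) If $n$ is even, then the eigenvalues of $\mathbf{H}_{n+2}$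 that are not of the form $\lambda_0$, $|\lambda_k|$, $\lambda_{\frac{n}{2}+1}$, $-|\lambda_k|$, $k=1,\ldots,\frac{n}{2}$, are precisely the zeros of the function $$g(t) = 1 + \frac{a}{n+2} G_{\frac{n}{2}}\left(t;\frac{2\pi}{n+2},\frac{2\pi}{n+2}\right) + \frac{b}{n+2} G_{\frac{n}{2}}(t;0,0) + \frac{ab}{(n+2)^2} G_{\frac{n}{2}}\left(t;\frac{2\pi}{n+2},\frac{2\pi}{n+2}\right) G_{\frac{n}{2}}(t;0,0) - \frac{ab}{(n+2)^2} \left[G_{\frac{n}{2}}\left(t;0,\frac{2\pi}{n+2}\right) - \frac{2}{t-\lambda_{\frac{n}{2}+1}}\right]^2 .$$ Moreover, if $\nu_1 \leqslant \nu_2 \leqslant \cdots \leqslant \nu_{n+2}$ are the eigenvalues of $\mathbf{H}_{n+2}$ and the $n+2$ numbers $\lambda_0$, $|\lambda_k|$, $\lambda_{\frac{n}{2}+1}$, $-|\lambda_k|$, $k=1,\ldots,\frac{n}{2}$, are arranged in non-decreasing order as $d_1 \leqslant d_2 \leqslant \cdots \leqslant d_{n+2}$, then $$d_k + \min\{0,-a,-b\} \leqslant \nu_k \leqslant d_k + \max\{0,-a,-b\}, \quad k=1,\ldots,n+2.$$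
   Context: $\mathbf{H}_{n+2}$ is the real $(n+2)\times(n+2)$ anti-tridiagonal Hankel matrix whose $(i,j)$ entry ($1\leqslant i,j\leqslant n+2$) is $a$ if $i+j=n+2$, $c$ if $i+j=n+3$, $b$ if $i+j=n+4$, and $0$ otherwise. Eigenvalues in ordered lists are repeated according to multiplicity, and likewise the numbers $d_k$ are listed with repetitions. Put $\omega := \mathrm{e}^{2\pi \mathrm{i}/(n+2)}$ (where $\mathrm{i}$ is the imaginary unit) and, for $k=0,1,\ldots,n+1$, $$\lambda_k := b + a\,\omega^{-nk} + c\,\omega^{-(n+1)k}, \qquad \theta_k := \arg(\lambda_k),$$ with $\arg$ the principal argument in $(-\pi,\pi]$ and $\arg(0)=0$. (The number $\lambda_0=a+b+c$ is real, and when $n$ is even $\lambda_{\frac n2+1}=a+b-c$ is real.) With $n$, and hence all $\lambda_k,\theta_k$, fixed, for an integer $m$ with $1\leqslant m\leqslant n$ and real $\alpha,\beta$ define $$F_m(t;\alpha,\beta) := \frac{1}{t-\lambda_0} + 2\sum_{k=1}^{m}\left[\frac{\cos\left(\frac{\theta_k}{2}-\alpha k\right)\cos\left(\frac{\theta_k}{2}-\beta k\right)}{t-|\lambda_k|} + \frac{\sin\left(\frac{\theta_k}{2}-\alpha k\right)\sin\left(\frac{\theta_k}{2}-\beta k\right)}{t+|\lambda_k|}\right],$$ $$G_m(t;\alpha,\beta) := \frac{1}{t-\lambda_0} + \frac{1}{t-\lambda_{m+1}} + 2\sum_{k=1}^{m}\left[\frac{\cos\left(\frac{\theta_k}{2}-\alpha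 k\right)\cos\left(\frac{\theta_k}{2}-\beta k\right)}{t-|\lambda_k|} + \frac{\sin\left(\frac{\theta_k}{2}-\alpha k\right)\sin\left(\frac{\theta_k}{2}-\beta k\right)}{t+|\lambda_k|}\right].$$ The functions $f$ and $g$ are regarded as functions of the real variable $t$ defined at those $t$ where none of the displayed denominators vanishes. *)

theory Defs
  imports Complex_Main "Jordan_Normal_Form.Char_Poly"
begin

text \<open>Matrices are indexed from 0, hence the successors in the conditions.\<close>

definition hankel :: "nat \<Rightarrow> real \<Rightarrow> real \<Rightarrow> real \<Rightarrow> real mat" where
  "hankel n a b c = mat (n + 2) (n + 2) (\<lambda>(i, j).
     if Suc i + Suc j = n + 2 then a
     else if Suc i + Suc j = n + 3 then c
     else if Suc i + Suc j = n + 4 then b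
     else 0)"

text \<open>
  The roots of the characteristic polynomial in the field of entries, repeated according to
  algebraic multiplicity, in non-decreasing order. For a symmetric real matrix these are all its
  eigenvalues, and algebraic and geometric multiplicities agree.
\<close>

definition eigenvalue_list :: "real mat \<Rightarrow> real list" where
  "eigenvalue_list A = sorted_list_of_multiset (proots (char_poly A))"

definition omega :: "nat \<Rightarrow> complex" where
  "omega n = exp (2 * of_real pi * \<i> / of_nat (n + 2))"

definition lam :: "nat \<Rightarrow> real \<Rightarrow> real \<Rightarrow> real \<Rightarrow> nat \<Rightarrow> complex" where
  "lam n a b c k = of_real b + of_real a * omega n powi (- (int n * int k))
     + of_real c * omega n powi (- (int (n + 1) * int k))"

definition theta :: "nat \<Rightarrow> real \<Rightarrow> real \<Rightarrow> real \<Rightarrow> nat \<Rightarrow> real" where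
  "theta n a b c k = Arg (lam n a b c k)"

text \<open>
  The values at index 0 and, for even \<open>n\<close>, at index \<open>n div 2 + 1\<close> are real, so that
  using their real parts below loses nothing.
\<close>

lemma lam_0: "lam n a b c 0 = of_real (a + b + c)"
  by (simp add: lam_def)

lemma lam_middle:
  assumes "even n"
  shows "lam n a b c (n div 2 + 1) = of_real (a + b - c)"
proof -
  obtain j where j: "n = 2 * j" using assms by (elim evenE)
  have "of_nat (j + 1) * (2 * of_real pi * \<i> / of_nat (n + 2)) = of_real pi * \<i>"
    by (simp add: j field_simps del: of_nat_Suc of_nat_add) (simp add: algebra_simps)
  then have w: "omega n ^ (j + 1) = -1"
    unfolding omega_def exp_of_nat_mult[symmetric] by (simp add: exp_pi_i)
  have p: "omega n powi (- (int m * int (j + 1))) = inverse ((-1) ^ m)" for m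
  proof -
    have "omega n powi (- (int m * int (j + 1))) = inverse (omega n ^ ((j + 1) * m))"
      by (simp only: of_nat_mult[symmetric] power_int_minus power_int_of_nat mult.commute)
    then show ?thesis by (simp only: power_mult w)
  qed
  show ?thesis
    unfolding lam_def using p[of n] p[of "n + 1"] by (simp add: j)
qed

definition F :: "nat \<Rightarrow> real \<Rightarrow> real \<Rightarrow> real \<Rightarrow> nat \<Rightarrow> real \<Rightarrow> real \<Rightarrow> real \<Rightarrow> real" where
  "F n a b c m t \<alpha> \<beta> =
     1 / (t - Re (lam n a b c 0))
     + 2 * (\<Sum>k = 1..m.
         cos (theta n a b c k / 2 - \<alpha> * real k) * cos (theta n a b c k / 2 - \<beta> * real k)
           / (t - cmod (lam n a b c k))
       + sin (theta n a b c k / 2 - \<alpha> * real k) * sin (theta n a b c k / 2 - \<beta> * real k)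
           / (t + cmod (lam n a b c k)))"

definition G :: "nat \<Rightarrow> real \<Rightarrow> real \<Rightarrow> real \<Rightarrow> nat \<Rightarrow> real \<Rightarrow> real \<Rightarrow> real \<Rightarrow> real" where
  "G n a b c m t \<alpha> \<beta> =
     1 / (t - Re (lam n a b c 0)) + 1 / (t - Re (lam n a b c (m + 1)))
     + 2 * (\<Sum>k = 1..m.
         cos (theta n a b c k / 2 - \<alpha> * real k) * cos (theta n a b c k / 2 - \<beta> * real k)
           / (t - cmod (lam n a b c k))
       + sin (theta n a b c k / 2 - \<alpha> * real k) * sin (theta n a b c k / 2 - \<beta> * real k)
           / (t + cmod (lam n a b c k)))"

definition f_odd :: "nat \<Rightarrow> real \<Rightarrow> real \<Rightarrow> real \<Rightarrow> real \<Rightarrow> real" where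
  "f_odd n a b c t =
    (let N = real n + 2; p = 2 * pi / N; m = (n + 1) div 2 in
      1 + a / N * F n a b c m t p p
        + b / N * F n a b c m t 0 0
        + a * b / N\<^sup>2 * F n a b c m t p p * F n a b c m t 0 0
        - a * b / N\<^sup>2 * (F n a b c m t 0 p)\<^sup>2)"

definition g_even :: "nat \<Rightarrow> real \<Rightarrow> real \<Rightarrow> real \<Rightarrow> real \<Rightarrow> real" where
  "g_even n a b c t =
    (let N = real n + 2; p = 2 * pi / N; m = n div 2 in
      1 + a / N * G n a b c m t p p
        + b / N * G n a b c m t 0 0
        + a * b / N\<^sup>2 * G n a b c m t p p * G n a b c m t 0 0
        - a * b / N\<^sup>2 * (G n a b c m t 0 p - 2 / (t - Re (lam n a b c (n div 2 + 1))))\<^sup>2)"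

text \<open>
  The lists of the numbers \<open>d\<^sub>k\<close>, with repetitions and before sorting. Their elements are exactly
  the points at which some denominator in \<open>f_odd\<close> or \<open>g_even\<close>, respectively, vanishes, so the
  complements of their element sets are the domains of these two functions.
\<close>

definition d_odd :: "nat \<Rightarrow> real \<Rightarrow> real \<Rightarrow> real \<Rightarrow> real list" where
  "d_odd n a b c =
     Re (lam n a b c 0)
     # map (\<lambda>k. cmod (lam n a b c k)) [1..<(n + 1) div 2 + 1]
     @ map (\<lambda>k. - cmod (lam n a b c k)) [1..<(n + 1) div 2 + 1]"

definition d_even :: "nat \<Rightarrow> real \<Rightarrow> real \<Rightarrow> real \<Rightarrow> real list" where
  "d_even n a b c =
     Re (lam n a b c 0)
     # Re (lam n a b c (n div 2 + 1))
     # map (\<lambda>k. cmod (lam n a b c k)) [1..<n div 2 + 1]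
     @ map (\<lambda>k. - cmod (lam n a b c k)) [1..<n div 2 + 1]"

end

theory Submission
  imports Defs "Jordan_Normal_Form.Spectral_Radius"
begin

text \<open>
  Put \<open>N = n + 2\<close>. Let \<open>C\<close> be the matrix whose entry at \<open>(x, y)\<close>, indices counted from 0,
  depends only on the residue of \<open>x + y\<close> modulo \<open>N\<close>: it is \<open>b\<close>, \<open>a\<close>, \<open>c\<close> for the residues
  \<open>0\<close>, \<open>N - 2\<close>, \<open>N - 1\<close>, and 0 otherwise. The Hankel matrix \<open>H\<close> differs from this cyclic completion
  only in two corners, where the wrapped diagonals come back:
  \<open>H = C - b e\<^sub>0 e\<^sub>0\<^sup>T - a e\<^sub>N\<^sub>-\<^sub>1 e\<^sub>N\<^sub>-\<^sub>1\<^sup>T\<close>.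

  The discrete Fourier transform diagonalises \<open>C\<close>. With \<open>v\<^sub>k = (\<omega>\<^sup>j\<^sup>k)\<^sub>j\<close> one has
  \<open>C v\<^sub>k = cnj \<lambda>\<^sub>k * cnj v\<^sub>k\<close>; multiplying \<open>v\<^sub>k\<close> by \<open>cis (\<theta>\<^sub>k / 2)\<close> turns this into
  \<open>C u = |\<lambda>\<^sub>k| cnj u\<close>, so that the real and imaginary parts of \<open>u\<close>, which are a cosine and a sine with
  phase \<open>\<theta>\<^sub>k / 2\<close>, are eigenvectors for \<open>|\<lambda>\<^sub>k|\<close> and \<open>- |\<lambda>\<^sub>k|\<close>. Both the completeness of
  these modes and the formula for the entries of \<open>C\<close> reduce to one geometric sum
  (\<open>sum_cos_grid_angle\<close>); the result is \<open>spectral_resolution_circulant\<close>.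

  The two assertions now follow from general facts about a symmetric matrix \<open>C\<close> perturbed in two
  diagonal entries.

  Off the spectrum of \<open>C\<close> let \<open>R = (t - C)\<^sup>-\<^sup>1\<close>. An eigenvector \<open>v\<close> of \<open>H\<close> for \<open>t\<close> satisfies
  \<open>v = - b v\<^sub>0 R e\<^sub>0 - a v\<^sub>N\<^sub>-\<^sub>1 R e\<^sub>N\<^sub>-\<^sub>1\<close>; reading off the two corner coordinates gives a
  homogeneous system of two equations, which is singular exactly when \<open>t\<close> is an eigenvalue
  (\<open>secular_equation\<close>). The corner entries of \<open>R\<close> are the functions \<open>F\<close>, respectively \<open>G\<close>,
  divided by \<open>N\<close> (for even \<open>n\<close> the term of \<open>\<lambda>\<^sub>N\<^sub>/\<^sub>2\<close> changes its sign in the mixed entry), and the determinant of the system is the function in the theorem.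

  The perturbation is a diagonal matrix with eigenvalues \<open>0\<close>, \<open>- a\<close>, \<open>- b\<close>, so the inequalities are
  Weyl's inequalities (\<open>weyl_inequalities\<close>). They compare ordered eigenvalues of two symmetric
  matrices and use an orthonormal eigenbasis of \<open>H\<close> too, which the real spectral theorem supplies.
\<close>

section \<open>Orthonormal eigenbases and functional calculus\<close>

text \<open>
  If the vectors in \<open>ps\<close> form an orthonormal basis, this is the matrix of \<open>f(A)\<close>, where \<open>A\<close> acts
  on each vector as multiplication by the number paired with it. A list of pairs is used, rather
  than a diagonal and an orthogonal matrix, because the eigenvalues that occur below come as a list
  with repetitions in which the order does not matter.
\<close>

definition fcalc :: "(real \<Rightarrow> real) \<Rightarrow> (real \<times> (nat \<Rightarrow> real)) list \<Rightarrow> nat \<Rightarrow> nat \<Rightarrow> real" where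
  "fcalc f ps x y = (\<Sum>p\<leftarrow>ps. f (fst p) * (snd p x * snd p y))"

text \<open>
  Orthonormality is encoded by completeness, \<open>\<Sum> u u\<^sup>T = 1\<close>: for \<open>N\<close> vectors in dimension \<open>N\<close>
  the two are equivalent, and completeness has the same shape as \<open>\<Sum> d u u\<^sup>T = M\<close>.
\<close>

definition spectral_resolution ::
    "nat \<Rightarrow> (nat \<Rightarrow> nat \<Rightarrow> real) \<Rightarrow> (real \<times> (nat \<Rightarrow> real)) list \<Rightarrow> bool" where
  "spectral_resolution N M ps \<longleftrightarrow> length ps = N
     \<and> (\<forall>x<N. \<forall>y<N. fcalc (\<lambda>_. 1) ps x y = (if x = y then 1 else 0))
     \<and> (\<forall>x<N. \<forall>y<N. fcalc (\<lambda>d. d) ps x y = M x y)"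

lemma fcalc_nth:
  assumes "length ps = N"
  shows "fcalc f ps x y = (\<Sum>i<N. f (fst (ps ! i)) * (snd (ps ! i) x * snd (ps ! i) y))"
  unfolding fcalc_def using assms by (simp add: sum_list_sum_nth atLeast0LessThan)

lemma fcalc_commute: "fcalc f ps x y = fcalc f ps y x"
  unfolding fcalc_def by (simp add: mult.commute)

text \<open>
  The vectors are the columns of a square matrix \<open>U\<close> with \<open>U U\<^sup>T = 1\<close>, and a right inverse of a
  square matrix is also a left inverse.
\<close>

lemma spectral_resolution_orthonormal:
  assumes r: "spectral_resolution N M ps" and ij: "i < N" "j < N"
  shows "(\<Sum>x<N. snd (ps ! i) x * snd (ps ! j) x) = (if i = j then 1 else 0)"
proof -
  have len: "length ps = N" using r by (simp add: spectral_resolution_def)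
  define U where "U = mat N N (\<lambda>(x, k). snd (ps ! k) x)"
  have U: "U \<in> carrier_mat N N" and UT: "transpose_mat U \<in> carrier_mat N N"
    by (auto simp: U_def)
  have "U * transpose_mat U = 1\<^sub>m N"
  proof (rule eq_matI)
    fix x y assume "x < dim_row (1\<^sub>m N)" "y < dim_col (1\<^sub>m N)"
    then have xy: "x < N" "y < N" by auto
    have "(U * transpose_mat U) $$ (x, y) = fcalc (\<lambda>_. 1) ps x y"
      unfolding fcalc_nth[OF len] using xy
      by (simp add: U_def scalar_prod_def atLeast0LessThan)
    then show "(U * transpose_mat U) $$ (x, y) = 1\<^sub>m N $$ (x, y)"
      using r xy by (simp add: spectral_resolution_def)
  qed (auto simp: U_def)
  from mat_mult_left_right_inverse[OF U UT this]
  have "(transpose_mat U * U) $$ (i, j) = 1\<^sub>m N $$ (i, j)" by simp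
  then show ?thesis
    using ij by (simp add: U_def scalar_prod_def atLeast0LessThan)
qed

text \<open>
  The functional calculus is multiplicative, because the products of distinct rank-one projections
  onto orthonormal vectors vanish. Taking \<open>1 / (t - d)\<close> and \<open>t - d\<close> yields the resolvent.
\<close>

lemma fcalc_mult:
  assumes r: "spectral_resolution N M ps"
  shows "(\<Sum>z<N. fcalc f ps x z * fcalc g ps z y) = fcalc (\<lambda>d. f d * g d) ps x y"
proof -
  have len: "length ps = N" using r by (simp add: spectral_resolution_def)
  define u where "u i = snd (ps ! i)" for i
  define F where "F i = f (fst (ps ! i))" for i
  define K where "K i = g (fst (ps ! i))" for i
  have "(\<Sum>z<N. fcalc f ps x z * fcalc g ps z y)
      = (\<Sum>z<N. \<Sum>i<N. \<Sum>j<N. F i * K j * u i x * u j y * (u i z * u j z))"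
    unfolding fcalc_nth[OF len] sum_product F_def K_def u_def
    by (intro sum.cong refl) (simp add: mult_ac)
  also have "\<dots> = (\<Sum>i<N. \<Sum>j<N. \<Sum>z<N. F i * K j * u i x * u j y * (u i z * u j z))"
    by (rule trans[OF sum.swap], rule sum.cong[OF refl], rule sum.swap)
  also have "\<dots> = (\<Sum>i<N. \<Sum>j<N. F i * K j * u i x * u j y * (if i = j then 1 else 0))"
    unfolding sum_distrib_left[symmetric]
    by (intro sum.cong refl)
       (simp add: spectral_resolution_orthonormal[OF r, folded u_def])
  also have "\<dots> = (\<Sum>i<N. F i * K i * (u i x * u i y))"
    by (intro sum.cong refl) (simp add: if_distrib sum.delta cong: if_cong)
  finally show ?thesis
    unfolding fcalc_nth[OF len] F_def K_def u_def .
qed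

lemma proots_prod_linear_factors:
  fixes ds :: "'a :: idom list"
  shows "proots (\<Prod>d\<leftarrow>ds. [:- d, 1:]) = mset ds"
proof (induct ds)
  case (Cons d ds)
  have "(\<Prod>d\<leftarrow>ds. [:- d, 1:]) \<noteq> 0" by (auto simp: prod_list_zero_iff)
  then have "proots ([:- d, 1:] * (\<Prod>d\<leftarrow>ds. [:- d, 1:])) = {#d#} + mset ds"
    by (subst proots_mult) (simp_all add: Cons)
  then show ?case by (simp del: mult_pCons_left)
qed simp

text \<open>
  The matrix is similar to the diagonal matrix of the numbers in the list, so these are the roots
  of the characteristic polynomial with the right multiplicities.
\<close>

lemma eigenvalue_list_spectral_resolution:
  assumes r: "spectral_resolution N M ps"
  shows "eigenvalue_list (mat N N (\<lambda>(i, j). M i j)) = sort (map fst ps)"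
proof -
  have len: "length ps = N" using r by (simp add: spectral_resolution_def)
  define A where "A = mat N N (\<lambda>(i, j). M i j)"
  define U where "U = mat N N (\<lambda>(x, k). snd (ps ! k) x)"
  define D where "D = mat N N (\<lambda>(i, j). if i = j then fst (ps ! i) else 0)"
  have carr: "A \<in> carrier_mat N N" "U \<in> carrier_mat N N" "D \<in> carrier_mat N N"
    "transpose_mat U \<in> carrier_mat N N"
    by (auto simp: A_def U_def D_def)
  have UU: "U * transpose_mat U = 1\<^sub>m N"
    using r by (intro eq_matI)
      (auto simp: U_def scalar_prod_def atLeast0LessThan spectral_resolution_def fcalc_nth[OF len])
  have UU': "transpose_mat U * U = 1\<^sub>m N"
    by (rule mat_mult_left_right_inverse[OF _ _ UU]) (use carr in auto)
  have A: "A = U * D * transpose_mat U"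
  proof (rule eq_matI)
    fix x y assume "x < dim_row (U * D * transpose_mat U)" "y < dim_col (U * D * transpose_mat U)"
    then have xy: "x < N" "y < N" by (auto simp: U_def)
    have UD: "(U * D) $$ (x, k) = fst (ps ! k) * snd (ps ! k) x" if "k < N" for k
      using that xy by (simp add: U_def D_def scalar_prod_def if_distrib sum.delta cong: if_cong)
    have "(U * D * transpose_mat U) $$ (x, y) = (\<Sum>k<N. (U * D) $$ (x, k) * U $$ (y, k))"
      using xy by (simp add: U_def D_def scalar_prod_def atLeast0LessThan)
    also have "\<dots> = fcalc (\<lambda>d. d) ps x y"
      unfolding fcalc_nth[OF len]
    proof (rule sum.cong[OF refl])
      fix k assume "k \<in> {..<N}"
      moreover from this have "U $$ (y, k) = snd (ps ! k) y" using xy by (simp add: U_def)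
      ultimately show "(U * D) $$ (x, k) * U $$ (y, k)
          = fst (ps ! k) * (snd (ps ! k) x * snd (ps ! k) y)"
        by (simp add: UD)
    qed
    finally show "A $$ (x, y) = (U * D * transpose_mat U) $$ (x, y)"
      using r xy by (simp add: A_def spectral_resolution_def)
  qed (auto simp: A_def U_def)
  have "similar_mat A D"
    unfolding similar_mat_def using similar_mat_witI[OF UU UU' A] carr by blast
  then have "char_poly A = char_poly D" by (rule char_poly_similar)
  also have "\<dots> = (\<Prod>a\<leftarrow>diag_mat D. [:- a, 1:])"
    by (rule char_poly_upper_triangular[OF carr(3)]) (auto simp: D_def)
  also have "diag_mat D = map fst ps"
    by (rule nth_equalityI) (auto simp: diag_mat_def D_def len)
  finally have "proots (char_poly A) = mset (map fst ps)"
    by (simp only: proots_prod_linear_factors)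
  then show ?thesis
    unfolding eigenvalue_list_def A_def[symmetric] by (simp only: sorted_list_of_multiset_mset)
qed

section \<open>The spectral theorem for real symmetric matrices\<close>

text \<open>
  Eigenvectors as coordinate functions of which only the values below \<open>N\<close> matter; all further
  arguments are carried out with finite sums instead of matrices.
\<close>

lemma eigenvalue_mat_iff:
  fixes M :: "nat \<Rightarrow> nat \<Rightarrow> 'a :: field"
  shows "eigenvalue (mat N N (\<lambda>(i, j). M i j)) t \<longleftrightarrow>
    (\<exists>v. (\<exists>x<N. v x \<noteq> 0) \<and> (\<forall>x<N. (\<Sum>y<N. M x y * v y) = t * v x))"
    (is "?L \<longleftrightarrow> ?R")
proof
  assume ?L
  then obtain v where v: "v \<in> carrier_vec N" "v \<noteq> 0\<^sub>v N"
    and e: "mat N N (\<lambda>(i, j). M i j) *\<^sub>v v = t \<cdot>\<^sub>v v"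
    by (auto simp: eigenvalue_def eigenvector_def)
  have "\<exists>x<N. v $ x \<noteq> 0" using v by (auto simp: vec_eq_iff)
  moreover have "(\<Sum>y<N. M x y * v $ y) = t * v $ x" if "x < N" for x
    using arg_cong[OF e, of "\<lambda>w. w $ x"] that v(1)
    by (simp add: scalar_prod_def atLeast0LessThan)
  ultimately show ?R by (intro exI[of _ "\<lambda>x. v $ x"]) auto
next
  assume ?R
  then obtain v where v: "\<exists>x<N. v x \<noteq> 0"
    and e: "\<And>x. x < N \<Longrightarrow> (\<Sum>y<N. M x y * v y) = t * v x" by blast
  have "vec N v \<noteq> 0\<^sub>v N" using v by (auto simp: vec_eq_iff)
  moreover have "mat N N (\<lambda>(i, j). M i j) *\<^sub>v vec N v = t \<cdot>\<^sub>v vec N v"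
    by (intro eq_vecI) (auto simp: scalar_prod_def atLeast0LessThan e)
  ultimately show ?L by (auto simp: eigenvalue_def eigenvector_def intro!: exI[of _ "vec N v"])
qed

text \<open>
  A complex eigenvector \<open>v\<close> exists, and \<open>v\<^sup>* M v = \<mu> |v|\<^sup>2\<close> is its own conjugate, so \<open>\<mu>\<close> is real.
  Then the real and the imaginary part of \<open>v\<close> satisfy the same equation, and one of them is
  nonzero.
\<close>

lemma symmetric_real_eigenvector:
  fixes M :: "nat \<Rightarrow> nat \<Rightarrow> real"
  assumes sym: "\<And>x y. x < N \<Longrightarrow> y < N \<Longrightarrow> M x y = M y x" and N: "N > 0"
  obtains e v where "(\<Sum>x<N. (v x)\<^sup>2) = 1" "\<And>x. x < N \<Longrightarrow> (\<Sum>y<N. M x y * v y) = e * v x"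
proof -
  let ?A = "mat N N (\<lambda>(i, j). complex_of_real (M i j))"
  have "spectrum ?A \<noteq> {}" by (rule spectrum_non_empty[OF _ N]) auto
  then obtain \<mu> where "eigenvalue ?A \<mu>" by (auto simp: spectrum_def)
  then obtain v where nz: "\<exists>x<N. v x \<noteq> 0"
    and ev: "\<And>x. x < N \<Longrightarrow> (\<Sum>y<N. complex_of_real (M x y) * v y) = \<mu> * v x"
    unfolding eigenvalue_mat_iff by blast
  define S where "S = (\<Sum>x<N. \<Sum>y<N. cnj (v x) * (complex_of_real (M x y) * v y))"
  define s where "s = (\<Sum>x<N. (cmod (v x))\<^sup>2)"
  have "S = (\<Sum>x<N. cnj (v x) * (\<mu> * v x))"
    unfolding S_def sum_distrib_left[symmetric] by (intro sum.cong refl) (simp add: ev)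
  also have "\<dots> = \<mu> * of_real s"
    unfolding s_def of_real_sum sum_distrib_left
    by (intro sum.cong refl) (simp add: complex_norm_square mult_ac del: of_real_power)
  finally have S: "S = \<mu> * of_real s" .
  have "cnj S = (\<Sum>x<N. \<Sum>y<N. v x * (complex_of_real (M x y) * cnj (v y)))"
    by (simp add: S_def)
  also have "\<dots> = (\<Sum>y<N. \<Sum>x<N. v x * (complex_of_real (M x y) * cnj (v y)))"
    by (rule sum.swap)
  also have "\<dots> = S"
    unfolding S_def by (intro sum.cong refl) (use sym in \<open>simp add: mult_ac\<close>)
  finally have "Im S = 0" by (simp add: complex_eq_iff)
  moreover obtain x0 where "x0 < N" "v x0 \<noteq> 0" using nz by blast
  then have "s > 0" unfolding s_def by (intro sum_pos2[of _ x0]) auto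
  ultimately have "Im \<mu> = 0" by (simp add: S)
  then have mu: "\<mu> = of_real (Re \<mu>)" by (simp add: complex_eq_iff)
  have re: "(\<Sum>y<N. M x y * Re (v y)) = Re \<mu> * Re (v x)"
    and im: "(\<Sum>y<N. M x y * Im (v y)) = Re \<mu> * Im (v x)" if "x < N" for x
    using arg_cong[OF ev[OF that], of Re] arg_cong[OF ev[OF that], of Im] \<open>Im \<mu> = 0\<close>
    by simp_all
  obtain w where w: "\<exists>x<N. w x \<noteq> 0"
    "\<And>x. x < N \<Longrightarrow> (\<Sum>y<N. M x y * w y) = Re \<mu> * w x"
  proof (cases "\<exists>x<N. Re (v x) \<noteq> 0")
    case True
    then show ?thesis using re by (intro that[of "\<lambda>x. Re (v x)"]) auto
  next
    case False
    with nz have "\<exists>x<N. Im (v x) \<noteq> 0" by (auto simp: complex_eq_iff)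
    then show ?thesis using im by (intro that[of "\<lambda>x. Im (v x)"]) auto
  qed
  define r where "r = sqrt (\<Sum>x<N. (w x)\<^sup>2)"
  obtain x0 where "x0 < N" "w x0 \<noteq> 0" using w(1) by blast
  then have "(\<Sum>x<N. (w x)\<^sup>2) > 0" by (intro sum_pos2[of _ x0]) auto
  then have r: "r > 0" "r\<^sup>2 = (\<Sum>x<N. (w x)\<^sup>2)" by (auto simp: r_def)
  show ?thesis
  proof (rule that[of "\<lambda>x. w x / r" "Re \<mu>"])
    have "(\<Sum>x<N. (w x / r)\<^sup>2) = (\<Sum>x<N. (w x)\<^sup>2) / r\<^sup>2"
      by (simp add: power_divide sum_divide_distrib)
    then show "(\<Sum>x<N. (w x / r)\<^sup>2) = 1" using r(1) by (simp flip: r(2))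
    show "(\<Sum>y<N. M x y * (w y / r)) = Re \<mu> * (w x / r)" if "x < N" for x
      using w(2)[OF that] by (simp add: sum_divide_distrib[symmetric])
  qed
qed

text \<open>
  The reflection in the hyperplane orthogonal to \<open>w = v - e\<^sub>0\<close> exchanges \<open>e\<^sub>0\<close> and \<open>v\<close>, so it is an
  orthogonal matrix with first column \<open>v\<close>; being symmetric it is its own inverse.
\<close>

lemma householder_reflection:
  fixes v :: "nat \<Rightarrow> real"
  assumes v: "(\<Sum>x<N. (v x)\<^sup>2) = 1" and N: "N > 0"
  obtains Q where "\<And>x y. Q x y = Q y x" "\<And>x. x < N \<Longrightarrow> Q x 0 = v x"
    "\<And>x y. x < N \<Longrightarrow> y < N \<Longrightarrow> (\<Sum>z<N. Q x z * Q z y) = (if x = y then 1 else 0)"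
proof -
  define \<delta> :: "nat \<Rightarrow> nat \<Rightarrow> real" where "\<delta> x y = (if x = y then 1 else 0)" for x y
  have \<delta>: "(\<Sum>z<N. \<delta> x z * g z) = g x" "(\<Sum>z<N. \<delta> z x * g z) = g x" if "x < N" for x g
    using that by (simp_all add: \<delta>_def if_distrib[of "\<lambda>c. c * _"] cong: if_cong)
  define w where "w x = v x - \<delta> x 0" for x
  define q where "q = (\<Sum>x<N. (w x)\<^sup>2)"
  have "q = (\<Sum>x<N. (v x)\<^sup>2 - 2 * (\<delta> x 0 * v x) + \<delta> x 0 * 1)"
    unfolding q_def w_def by (intro sum.cong refl) (auto simp: \<delta>_def power2_eq_square algebra_simps)
  also have "\<dots> = 2 - 2 * v 0"
    unfolding sum.distrib sum_subtractf sum_distrib_left[symmetric] \<delta>(2)[OF N] using v by simp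
  finally have q: "q = - 2 * w 0" by (simp add: w_def \<delta>_def)
  \<comment> \<open>If \<open>v = e\<^sub>0\<close>, then \<open>q = 0\<close>; division by zero gives \<open>s = 0\<close>, hence the identity matrix, as it should.\<close>
  define s where "s = 2 / q"
  have sw: "s * w 0 * w x = - w x" if "x < N" for x
  proof (cases "q = 0")
    case True
    then have "w x = 0" using that unfolding q_def by (subst (asm) sum_nonneg_eq_0_iff) auto
    then show ?thesis by simp
  next
    case False
    then show ?thesis using q by (simp add: s_def field_simps)
  qed
  define Q where "Q x y = \<delta> x y - s * (w x * w y)" for x y
  show ?thesis
  proof (rule that[of Q])
    show "Q x y = Q y x" for x y by (simp add: Q_def \<delta>_def mult.commute)
    show "Q x 0 = v x" if "x < N" for x
      using sw[OF that] by (simp add: Q_def mult_ac) (simp add: w_def)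
    fix x y assume xy: "x < N" "y < N"
    have "(\<Sum>z<N. Q x z * Q z y) = (\<Sum>z<N. \<delta> x z * \<delta> z y - s * w y * (\<delta> x z * w z)
        - s * w x * (\<delta> z y * w z) + s\<^sup>2 * w x * w y * (w z)\<^sup>2)"
      unfolding Q_def by (intro sum.cong refl) (simp add: algebra_simps power2_eq_square)
    also have "\<dots> = \<delta> x y - 2 * s * (w x * w y) + s\<^sup>2 * w x * w y * q"
      unfolding sum.distrib sum_subtractf sum_distrib_left[symmetric] \<delta>(1)[OF xy(1)] \<delta>(2)[OF xy(2)]
        q_def[symmetric] by (simp add: algebra_simps)
    also have "\<dots> = \<delta> x y" by (simp add: s_def power2_eq_square)
    finally show "(\<Sum>z<N. Q x z * Q z y) = (if x = y then 1 else 0)" by (simp add: \<delta>_def)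
  qed
qed

definition mprod :: "nat \<Rightarrow> (nat \<Rightarrow> nat \<Rightarrow> real) \<Rightarrow> (nat \<Rightarrow> nat \<Rightarrow> real) \<Rightarrow> nat \<Rightarrow> nat \<Rightarrow> real" where
  "mprod N A B x y = (\<Sum>z<N. A x z * B z y)"

lemma mprod_assoc: "mprod N (mprod N A B) C = mprod N A (mprod N B C)"
proof (intro ext)
  fix x y
  have "mprod N (mprod N A B) C x y = (\<Sum>z<N. \<Sum>w<N. A x w * B w z * C z y)"
    by (simp add: mprod_def sum_distrib_right)
  also have "\<dots> = (\<Sum>w<N. \<Sum>z<N. A x w * B w z * C z y)" by (rule sum.swap)
  also have "\<dots> = mprod N A (mprod N B C) x y"
    by (simp add: mprod_def sum_distrib_left mult.assoc)
  finally show "mprod N (mprod N A B) C x y = mprod N A (mprod N B C) x y" .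
qed

text \<open>
  Induction on the dimension. A reflection \<open>Q\<close> moves a unit eigenvector to \<open>e\<^sub>0\<close>, so in
  \<open>B = Q M Q\<close> the first row and column vanish off the diagonal; the remaining block is symmetric,
  and \<open>Q\<close> carries its eigenbasis back.
\<close>

theorem spectral_theorem:
  fixes M :: "nat \<Rightarrow> nat \<Rightarrow> real"
  assumes "\<And>x y. x < N \<Longrightarrow> y < N \<Longrightarrow> M x y = M y x"
  shows "\<exists>ps. spectral_resolution N M ps"
  using assms
proof (induction N arbitrary: M)
  case 0
  then show ?case by (auto simp: spectral_resolution_def)
next
  case (Suc n)
  let ?N = "Suc n"
  note sym = Suc.prems
  obtain e v where v: "(\<Sum>x<?N. (v x)\<^sup>2) = 1"
    and ev: "\<And>x. x < ?N \<Longrightarrow> (\<Sum>y<?N. M x y * v y) = e * v x"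
    by (rule symmetric_real_eigenvector[of ?N M, OF sym zero_less_Suc]) (assumption | rule that)+
  obtain Q where Qs: "\<And>x y. Q x y = Q y x" and Q0: "\<And>x. x < ?N \<Longrightarrow> Q x 0 = v x"
    and QQ: "\<And>x y. x < ?N \<Longrightarrow> y < ?N \<Longrightarrow> (\<Sum>z<?N. Q x z * Q z y) = (if x = y then 1 else 0)"
    by (rule householder_reflection[OF v zero_less_Suc]) (assumption | rule that)+
  define B where "B = mprod ?N Q (mprod ?N M Q)"
  have MQ0: "mprod ?N M Q x 0 = e * Q x 0" if "x < ?N" for x
    using ev[OF that] that by (simp add: mprod_def Q0 del: sum.lessThan_Suc)
  have B0: "B x 0 = (if x = 0 then e else 0)" if "x < ?N" for x
  proof -
    have "B x 0 = (\<Sum>z<?N. Q x z * (e * Q z 0))"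
      unfolding B_def mprod_def[of _ Q] by (intro sum.cong refl) (simp add: MQ0)
    also have "\<dots> = e * (\<Sum>z<?N. Q x z * Q z 0)"
      unfolding sum_distrib_left by (intro sum.cong refl) simp
    finally show ?thesis using QQ[OF that, of 0] by simp
  qed
  have Bs: "B x y = B y x" for x y
  proof -
    have "B x y = (\<Sum>z<?N. \<Sum>w<?N. Q x z * (M z w * Q w y))"
      by (simp only: B_def mprod_def sum_distrib_left)
    also have "\<dots> = (\<Sum>w<?N. \<Sum>z<?N. Q x z * (M z w * Q w y))" by (rule sum.swap)
    also have "\<dots> = (\<Sum>w<?N. \<Sum>z<?N. Q y w * (M w z * Q z x))"
      by (intro sum.cong refl) (use Qs[of x] Qs[of y] sym in \<open>simp add: mult_ac\<close>)
    also have "\<dots> = B y x" by (simp only: B_def mprod_def sum_distrib_left)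
    finally show ?thesis .
  qed
  have B00: "B 0 0 = e" "B (Suc j) 0 = 0" "B 0 (Suc j) = 0" if "j < n" for j
    using B0[of 0] B0[of "Suc j"] Bs[of 0 "Suc j"] that by simp_all
  have QBQ: "(\<Sum>j<?N. \<Sum>l<?N. Q x j * Q y l * B j l) = M x y" if xy: "x < ?N" "y < ?N" for x y
  proof -
    have "(\<Sum>j<?N. \<Sum>l<?N. Q x j * Q y l * B j l) = mprod ?N Q (mprod ?N B Q) x y"
      unfolding mprod_def[of _ Q] mprod_def[of _ B] sum_distrib_left
      by (intro sum.cong refl) (use Qs[of y] in \<open>simp add: mult_ac\<close>)
    also have "mprod ?N Q (mprod ?N B Q) = mprod ?N (mprod ?N Q Q) (mprod ?N M (mprod ?N Q Q))"
      by (simp add: B_def mprod_assoc)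
    also have "\<dots> x y = (\<Sum>z<?N. (if x = z then 1 else 0) * (\<Sum>w<?N. M z w * (if w = y then 1 else 0)))"
      unfolding mprod_def using QQ xy by (intro sum.cong refl arg_cong2[of _ _ _ _ "(*)"]) auto
    also have "\<dots> = M x y" using xy
      by (simp add: if_distrib[of "\<lambda>c. c * _"] if_distrib[of "\<lambda>c. _ * c"] cong: if_cong del: sum.lessThan_Suc)
    finally show ?thesis .
  qed
  obtain ps where ps: "spectral_resolution n (\<lambda>i j. B (Suc i) (Suc j)) ps"
    using Suc.IH[of "\<lambda>i j. B (Suc i) (Suc j)"] Bs by blast
  define ps' where "ps' = (e, \<lambda>x. Q x 0)
    # map (\<lambda>p. (fst p, \<lambda>x. \<Sum>j<n. Q x (Suc j) * snd p j)) ps"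
  have len: "length ps = n" using ps by (simp add: spectral_resolution_def)
  have fc: "fcalc f ps' x y = f e * (Q x 0 * Q y 0)
      + (\<Sum>j<n. \<Sum>l<n. Q x (Suc j) * Q y (Suc l) * fcalc f ps j l)" for f x y
  proof -
    have "fcalc f (tl ps') x y = (\<Sum>i<n. f (fst (ps ! i))
        * ((\<Sum>j<n. Q x (Suc j) * snd (ps ! i) j) * (\<Sum>l<n. Q y (Suc l) * snd (ps ! i) l)))"
      by (subst fcalc_nth[of _ n]) (simp_all add: ps'_def len)
    also have "\<dots> = (\<Sum>i<n. \<Sum>j<n. \<Sum>l<n. Q x (Suc j) * Q y (Suc l)
        * (f (fst (ps ! i)) * (snd (ps ! i) j * snd (ps ! i) l)))"
      unfolding sum_product unfolding sum_distrib_left by (intro sum.cong refl) (simp add: mult_ac)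
    also have "\<dots> = (\<Sum>j<n. \<Sum>l<n. \<Sum>i<n. Q x (Suc j) * Q y (Suc l)
        * (f (fst (ps ! i)) * (snd (ps ! i) j * snd (ps ! i) l)))"
      by (rule trans[OF sum.swap], rule sum.cong[OF refl], rule sum.swap)
    also have "\<dots> = (\<Sum>j<n. \<Sum>l<n. Q x (Suc j) * Q y (Suc l) * fcalc f ps j l)"
      by (simp add: fcalc_nth[OF len] sum_distrib_left)
    finally show ?thesis by (simp add: ps'_def fcalc_def)
  qed
  have "fcalc (\<lambda>_. 1) ps' x y = (if x = y then 1 else 0)" if xy: "x < ?N" "y < ?N" for x y
  proof -
    have "fcalc (\<lambda>_. 1) ps' x y
        = Q x 0 * Q y 0 + (\<Sum>j<n. \<Sum>l<n. Q x (Suc j) * Q y (Suc l) * (if j = l then 1 else 0))"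
      unfolding fc using ps by (simp add: spectral_resolution_def)
    also have "\<dots> = (\<Sum>j<?N. Q x j * Q j y)"
      unfolding sum.lessThan_Suc_shift using Qs[of y]
      by (simp add: if_distrib[of "\<lambda>c. _ * c"] cong: if_cong)
    finally show ?thesis using QQ[OF xy] by simp
  qed
  moreover have "fcalc (\<lambda>d. d) ps' x y = M x y" if xy: "x < ?N" "y < ?N" for x y
  proof -
    have "fcalc (\<lambda>d. d) ps' x y
        = e * (Q x 0 * Q y 0) + (\<Sum>j<n. \<Sum>l<n. Q x (Suc j) * Q y (Suc l) * B (Suc j) (Suc l))"
      unfolding fc using ps by (simp add: spectral_resolution_def)
    also have "\<dots> = (\<Sum>j<?N. \<Sum>l<?N. Q x j * Q y l * B j l)"
      unfolding sum.lessThan_Suc_shift using B00 B0[of 0] by (simp add: mult_ac)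
    finally show ?thesis using QBQ[OF xy] by simp
  qed
  ultimately have "spectral_resolution ?N M ps'"
    by (simp add: spectral_resolution_def ps'_def len)
  then show ?case by blast
qed

section \<open>Weyl's inequalities\<close>

text \<open>
  This allows sorting the eigenbasis by eigenvalue.
\<close>

lemma spectral_resolution_mset:
  assumes r: "spectral_resolution N M ps" and "mset qs = mset ps"
  shows "spectral_resolution N M qs"
proof -
  have "length qs = length ps" using assms(2) by (rule mset_eq_length)
  moreover have "fcalc f qs x y = fcalc f ps x y" for f x y
    unfolding fcalc_def sum_mset_sum_list[symmetric] mset_map assms(2) by (rule refl)
  ultimately show ?thesis using r by (simp add: spectral_resolution_def)
qed

text \<open>
  The quadratic form and the square of the norm in coordinates with respect to the eigenbasis.
\<close>

lemma quadratic_form_spectral: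
  assumes r: "spectral_resolution N M ps"
  shows "(\<Sum>x<N. \<Sum>y<N. v x * M x y * v y)
           = (\<Sum>i<N. fst (ps ! i) * (\<Sum>x<N. snd (ps ! i) x * v x)\<^sup>2)"
    and "(\<Sum>x<N. (v x)\<^sup>2) = (\<Sum>i<N. (\<Sum>x<N. snd (ps ! i) x * v x)\<^sup>2)"
proof -
  have len: "length ps = N" using r by (simp add: spectral_resolution_def)
  have fc: "(\<Sum>x<N. \<Sum>y<N. v x * fcalc f ps x y * v y)
      = (\<Sum>i<N. f (fst (ps ! i)) * (\<Sum>x<N. snd (ps ! i) x * v x)\<^sup>2)" for f
  proof -
    have "(\<Sum>x<N. \<Sum>y<N. v x * fcalc f ps x y * v y)
        = (\<Sum>x<N. \<Sum>y<N. \<Sum>i<N. f (fst (ps ! i)) * (snd (ps ! i) x * v x * (snd (ps ! i) y * v y)))"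
      by (simp add: fcalc_nth[OF len] sum_distrib_left sum_distrib_right mult_ac)
    also have "\<dots> = (\<Sum>i<N. \<Sum>x<N. \<Sum>y<N. f (fst (ps ! i)) * (snd (ps ! i) x * v x * (snd (ps ! i) y * v y)))"
      by (rule sym, rule trans[OF sum.swap], rule sum.cong[OF refl], rule sum.swap)
    also have "\<dots> = (\<Sum>i<N. f (fst (ps ! i)) * (\<Sum>x<N. snd (ps ! i) x * v x)\<^sup>2)"
      unfolding power2_eq_square sum_product unfolding sum_distrib_left by (rule refl)
    finally show ?thesis .
  qed
  show "(\<Sum>x<N. \<Sum>y<N. v x * M x y * v y)
           = (\<Sum>i<N. fst (ps ! i) * (\<Sum>x<N. snd (ps ! i) x * v x)\<^sup>2)"
    using fc[of "\<lambda>d. d"] r by (simp add: spectral_resolution_def)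
  have "(\<Sum>x<N. (v x)\<^sup>2) = (\<Sum>x<N. \<Sum>y<N. v x * (if x = y then 1 else 0) * v y)"
    by (intro sum.cong refl)
      (simp add: if_distrib[of "\<lambda>c. _ * c"] if_distrib[of "\<lambda>c. c * _"] power2_eq_square cong: if_cong)
  also have "\<dots> = (\<Sum>i<N. (\<Sum>x<N. snd (ps ! i) x * v x)\<^sup>2)"
    using fc[of "\<lambda>d. 1"] r by (simp add: spectral_resolution_def)
  finally show "(\<Sum>x<N. (v x)\<^sup>2) = (\<Sum>i<N. (\<Sum>x<N. snd (ps ! i) x * v x)\<^sup>2)" .
qed

text \<open>
  \<open>N - 1\<close> homogeneous linear equations in \<open>N\<close> unknowns have a nontrivial solution: replace the
  omitted equation by a zero row, which makes the determinant vanish.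
\<close>

lemma common_orthogonal_vector:
  fixes R :: "nat \<Rightarrow> nat \<Rightarrow> real"
  assumes k: "k < N"
  shows "\<exists>v. (\<Sum>x<N. (v x)\<^sup>2) > 0 \<and> (\<forall>i<N. i \<noteq> k \<longrightarrow> (\<Sum>x<N. R i x * v x) = 0)"
proof -
  define A where "A = mat\<^sub>r N N (\<lambda>i. if i = k then 0\<^sub>v N else vec N (R i))"
  have A: "A \<in> carrier_mat N N" by (simp add: A_def)
  have "det A = 0" unfolding A_def by (rule det_row_0[OF k]) auto
  then obtain v where v: "v \<in> carrier_vec N" "v \<noteq> 0\<^sub>v N" "A *\<^sub>v v = 0\<^sub>v N"
    using det_0_iff_vec_prod_zero[OF A] by blast
  obtain x0 where x0: "x0 < N" "v $ x0 \<noteq> 0" using v by (auto simp: vec_eq_iff)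
  show ?thesis
  proof (intro exI[of _ "\<lambda>x. v $ x"] conjI allI impI)
    show "(\<Sum>x<N. (v $ x)\<^sup>2) > 0" using x0 by (intro sum_pos2[of _ x0]) auto
    show "(\<Sum>x<N. R i x * v $ x) = 0" if "i < N" "i \<noteq> k" for i
      using arg_cong[OF v(3), of "\<lambda>w. w $ i"] that v(1)
      by (simp add: A_def scalar_prod_def atLeast0LessThan)
  qed
qed

text \<open>
  The argument behind the Courant-Fischer principle. By counting dimensions, some nonzero \<open>v\<close> is
  orthogonal to the eigenvectors of \<open>B\<close> before position \<open>k\<close> and to those of \<open>A\<close> after it. On such a
  \<open>v\<close> the form of \<open>B\<close> is at least its \<open>k\<close>-th eigenvalue times \<open>|v|\<^sup>2\<close>, and the form of \<open>A\<close> is at most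
  its \<open>k\<close>-th eigenvalue times \<open>|v|\<^sup>2\<close>.
\<close>

lemma ordered_eigenvalues_le:
  assumes A: "spectral_resolution N A ps" "sorted (map fst ps)"
    and B: "spectral_resolution N B qs" "sorted (map fst qs)"
    and le: "\<And>v. (\<Sum>x<N. \<Sum>y<N. v x * B x y * v y)
                \<le> (\<Sum>x<N. \<Sum>y<N. v x * A x y * v y) + \<delta> * (\<Sum>x<N. (v x)\<^sup>2)"
    and k: "k < N"
  shows "fst (qs ! k) \<le> fst (ps ! k) + \<delta>"
proof -
  have len: "length ps = N" "length qs = N"
    using A B by (simp_all add: spectral_resolution_def)
  define R where "R i = (if i < k then snd (qs ! i) else snd (ps ! i))" for i
  obtain v where pos: "(\<Sum>x<N. (v x)\<^sup>2) > 0"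
    and orth: "\<forall>i<N. i \<noteq> k \<longrightarrow> (\<Sum>x<N. R i x * v x) = 0"
    using common_orthogonal_vector[OF k, of R] by blast
  have below: "(\<Sum>x<N. snd (qs ! i) x * v x) = 0" if "i < k" for i
    using orth[rule_format, of i] that k by (simp add: R_def)
  have above: "(\<Sum>x<N. snd (ps ! i) x * v x) = 0" if "i < N" "k < i" for i
    using orth[rule_format, of i] that k by (simp add: R_def)
  have "fst (qs ! k) * (\<Sum>x<N. (v x)\<^sup>2) \<le> (\<Sum>x<N. \<Sum>y<N. v x * B x y * v y)"
    unfolding quadratic_form_spectral[OF B(1), of v] sum_distrib_left
  proof (rule sum_mono)
    fix i assume i: "i \<in> {..<N}"
    show "fst (qs ! k) * (\<Sum>x<N. snd (qs ! i) x * v x)\<^sup>2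
        \<le> fst (qs ! i) * (\<Sum>x<N. snd (qs ! i) x * v x)\<^sup>2"
    proof (cases "i < k")
      case False
      then have "fst (qs ! k) \<le> fst (qs ! i)"
        using sorted_nth_mono[OF B(2), of k i] i k by (simp add: len)
      then show ?thesis by (simp add: mult_right_mono)
    qed (simp add: below)
  qed
  also have "\<dots> \<le> (\<Sum>x<N. \<Sum>y<N. v x * A x y * v y) + \<delta> * (\<Sum>x<N. (v x)\<^sup>2)" by (rule le)
  also have "(\<Sum>x<N. \<Sum>y<N. v x * A x y * v y) \<le> fst (ps ! k) * (\<Sum>x<N. (v x)\<^sup>2)"
    unfolding quadratic_form_spectral[OF A(1), of v] sum_distrib_left
  proof (rule sum_mono)
    fix i assume i: "i \<in> {..<N}"
    show "fst (ps ! i) * (\<Sum>x<N. snd (ps ! i) x * v x)\<^sup>2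
        \<le> fst (ps ! k) * (\<Sum>x<N. snd (ps ! i) x * v x)\<^sup>2"
    proof (cases "k < i")
      case False
      then have "fst (ps ! i) \<le> fst (ps ! k)"
        using sorted_nth_mono[OF A(2), of i k] i k by (simp add: len)
      then show ?thesis by (simp add: mult_right_mono)
    qed (use i in \<open>simp add: above\<close>)
  qed
  finally have "fst (qs ! k) * (\<Sum>x<N. (v x)\<^sup>2) \<le> (fst (ps ! k) + \<delta>) * (\<Sum>x<N. (v x)\<^sup>2)"
    by (simp add: distrib_right)
  then show ?thesis using pos by simp
qed

text \<open>
  Both bounds are one comparison of quadratic forms, used in either direction. The spectral theorem
  for \<open>B\<close> also shows that all \<open>N\<close> roots of its characteristic polynomial are real.
\<close>

theorem weyl_inequalities:
  assumes A: "spectral_resolution N A ps"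
    and symB: "\<And>x y. x < N \<Longrightarrow> y < N \<Longrightarrow> B x y = B y x"
    and lower: "\<And>v. l * (\<Sum>x<N. (v x)\<^sup>2) \<le> (\<Sum>x<N. \<Sum>y<N. v x * (B x y - A x y) * v y)"
    and upper: "\<And>v. (\<Sum>x<N. \<Sum>y<N. v x * (B x y - A x y) * v y) \<le> u * (\<Sum>x<N. (v x)\<^sup>2)"
  defines "\<mu> \<equiv> eigenvalue_list (mat N N (\<lambda>(i, j). B i j))"
  shows "length \<mu> = N"
    and "k < N \<Longrightarrow> sort (map fst ps) ! k + l \<le> \<mu> ! k"
    and "k < N \<Longrightarrow> \<mu> ! k \<le> sort (map fst ps) ! k + u"
proof -
  have sort_fst: "sort (map fst rs) = map fst (sort_key fst rs)" for rs :: "(real \<times> (nat \<Rightarrow> real)) list"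
    by (rule properties_for_sort) simp_all
  obtain qs where B: "spectral_resolution N B qs" using spectral_theorem[of N B, OF symB] by blast
  have mu: "\<mu> = map fst (sort_key fst qs)"
    unfolding \<mu>_def eigenvalue_list_spectral_resolution[OF B] by (rule sort_fst)
  have A': "spectral_resolution N A (sort_key fst ps)" "sorted (map fst (sort_key fst ps))"
    and B': "spectral_resolution N B (sort_key fst qs)" "sorted (map fst (sort_key fst qs))"
    using A B by (auto intro: spectral_resolution_mset)
  have len: "length ps = N" "length qs = N" using A B by (simp_all add: spectral_resolution_def)
  then show "length \<mu> = N" by (simp add: mu)
  have diff: "(\<Sum>x<N. \<Sum>y<N. v x * (B x y - A x y) * v y)
      = (\<Sum>x<N. \<Sum>y<N. v x * B x y * v y) - (\<Sum>x<N. \<Sum>y<N. v x * A x y * v y)" for v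
    by (simp add: right_diff_distrib left_diff_distrib sum_subtractf)
  show "sort (map fst ps) ! k + l \<le> \<mu> ! k" if k: "k < N"
  proof -
    have "fst (sort_key fst ps ! k) \<le> fst (sort_key fst qs ! k) + - l"
    proof (rule ordered_eigenvalues_le[OF B' A' _ k])
      fix v
      show "(\<Sum>x<N. \<Sum>y<N. v x * A x y * v y)
          \<le> (\<Sum>x<N. \<Sum>y<N. v x * B x y * v y) + - l * (\<Sum>x<N. (v x)\<^sup>2)"
        using lower[of v] diff[of v] by linarith
    qed
    then show ?thesis using k by (simp add: mu sort_fst len)
  qed
  show "\<mu> ! k \<le> sort (map fst ps) ! k + u" if k: "k < N"
  proof -
    have "fst (sort_key fst qs ! k) \<le> fst (sort_key fst ps ! k) + u"
    proof (rule ordered_eigenvalues_le[OF A' B' _ k])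
      fix v
      show "(\<Sum>x<N. \<Sum>y<N. v x * B x y * v y)
          \<le> (\<Sum>x<N. \<Sum>y<N. v x * A x y * v y) + u * (\<Sum>x<N. (v x)\<^sup>2)"
        using upper[of v] diff[of v] by linarith
    qed
    then show ?thesis using k by (simp add: mu sort_fst len)
  qed
qed

section \<open>Perturbation of two diagonal entries\<close>

lemma two_by_two_singular:
  fixes a b c d :: "'a :: field"
  shows "(\<exists>v w. (v \<noteq> 0 \<or> w \<noteq> 0) \<and> a * v + b * w = 0 \<and> c * v + d * w = 0) \<longleftrightarrow> a * d - b * c = 0"
proof
  assume "\<exists>v w. (v \<noteq> 0 \<or> w \<noteq> 0) \<and> a * v + b * w = 0 \<and> c * v + d * w = 0"
  then obtain v w where nz: "v \<noteq> 0 \<or> w \<noteq> 0" and e: "a * v + b * w = 0" "c * v + d * w = 0" by blast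
  have "(a * d - b * c) * v = d * (a * v + b * w) - b * (c * v + d * w)"
    "(a * d - b * c) * w = a * (c * v + d * w) - c * (a * v + b * w)"
    by (simp_all add: algebra_simps)
  then show "a * d - b * c = 0" using nz unfolding e by auto
next
  assume z: "a * d - b * c = 0"
  show "\<exists>v w. (v \<noteq> 0 \<or> w \<noteq> 0) \<and> a * v + b * w = 0 \<and> c * v + d * w = 0"
  proof (cases "a = 0 \<and> b = 0")
    case True
    show ?thesis
    proof (cases "c = 0 \<and> d = 0")
      case True
      with \<open>a = 0 \<and> b = 0\<close> show ?thesis by (intro exI[of _ 1] exI[of _ 0]) simp
    next
      case False
      with \<open>a = 0 \<and> b = 0\<close> show ?thesis
        by (intro exI[of _ "- d"] exI[of _ c]) (auto simp: algebra_simps)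
    qed
  next
    case False
    then show ?thesis
      using z by (intro exI[of _ "- b"] exI[of _ a]) (auto simp: algebra_simps)
  qed
qed

text \<open>
  With \<open>T = t - M\<close> and \<open>R = T\<^sup>-\<^sup>1\<close>, the eigenvalue equation reads
  \<open>T v = - \<beta> v\<^sub>p e\<^sub>p - \<alpha> v\<^sub>q e\<^sub>q\<close>, that is, \<open>v = - \<beta> v\<^sub>p R e\<^sub>p - \<alpha> v\<^sub>q R e\<^sub>q\<close>. Thus \<open>v\<close> is determined
  by \<open>v\<^sub>p\<close> and \<open>v\<^sub>q\<close>, and the condition that it reproduces these two coordinates is a homogeneous
  two-by-two system.
\<close>

theorem secular_equation:
  assumes r: "spectral_resolution N M ps" and pq: "p < N" "q < N" "p \<noteq> q"
    and t: "t \<notin> fst ` set ps"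
  defines "R \<equiv> fcalc (\<lambda>d. 1 / (t - d)) ps"
  shows "eigenvalue (mat N N (\<lambda>(x, y). M x y
              - (if x = p \<and> y = p then \<beta> else 0) - (if x = q \<and> y = q then \<alpha> else 0))) t
          \<longleftrightarrow> (1 + \<alpha> * R q q) * (1 + \<beta> * R p p) - \<alpha> * \<beta> * (R p q)\<^sup>2 = 0"
proof -
  define T where "T = fcalc (\<lambda>d. t - d) ps"
  have one: "fcalc (\<lambda>d. 1) ps x y = (if x = y then 1 else 0)"
    and M: "fcalc (\<lambda>d. d) ps x y = M x y" if "x < N" "y < N" for x y
    using r that by (simp_all add: spectral_resolution_def)
  have cong: "fcalc f ps x y = fcalc g ps x y" if "\<And>d. d \<in> fst ` set ps \<Longrightarrow> f d = g d" for f g x y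
    unfolding fcalc_def using that by (intro arg_cong[of _ _ sum_list] map_cong) auto
  have nz: "t \<noteq> d" if "d \<in> fst ` set ps" for d using t that by blast
  have RT: "(\<Sum>z<N. R x z * T z y) = (if x = y then 1 else 0)"
    and TR: "(\<Sum>z<N. T x z * R z y) = (if x = y then 1 else 0)" if "x < N" "y < N" for x y
    unfolding R_def T_def fcalc_mult[OF r] one[OF that, symmetric]
    by (rule cong, simp add: nz)+
  have T: "T x y = t * (if x = y then 1 else 0) - M x y" if "x < N" "y < N" for x y
    unfolding one[OF that, symmetric] M[OF that, symmetric]
    by (simp add: T_def fcalc_def sum_list_const_mult[symmetric] sum_list_subtractf[symmetric] algebra_simps)
  have Rs: "R q p = R p q" unfolding R_def by (rule fcalc_commute)
  have pert: "(\<Sum>y<N. (M x y - (if x = p \<and> y = p then \<beta> else 0) - (if x = q \<and> y = q then \<alpha> else 0)) * v y)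
      = t * v x - (\<Sum>y<N. T x y * v y) - (if x = p then \<beta> * v p else 0) - (if x = q then \<alpha> * v q else 0)"
    if x: "x < N" for x v
  proof -
    have "(\<Sum>y<N. (M x y - (if x = p \<and> y = p then \<beta> else 0) - (if x = q \<and> y = q then \<alpha> else 0)) * v y)
      = (\<Sum>y<N. (if x = y then t * v y else 0) - T x y * v y
            - (if y = p then (if x = p then \<beta> * v y else 0) else 0)
            - (if y = q then (if x = q then \<alpha> * v y else 0) else 0))"
      by (intro sum.cong refl) (auto simp: T x algebra_simps)
    also have "\<dots> = t * v x - (\<Sum>y<N. T x y * v y) - (if x = p then \<beta> * v p else 0) - (if x = q then \<alpha> * v q else 0)"
      unfolding sum_subtractf using x pq by simp
    finally show ?thesis .
  qed
  define rhs where "rhs v x = - (if x = p then \<beta> * v p else 0) - (if x = q then \<alpha> * v q else 0)"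
    for v and x :: nat
  have R_rhs: "(\<Sum>z<N. R x z * rhs v z) = - (\<beta> * v p) * R x p - \<alpha> * v q * R x q" for v x
  proof -
    have "(\<Sum>z<N. R x z * rhs v z)
        = (\<Sum>z<N. (if z = p then - (\<beta> * v p) * R x z else 0) - (if z = q then \<alpha> * v q * R x z else 0))"
      by (intro sum.cong refl) (auto simp: rhs_def algebra_simps)
    also have "\<dots> = - (\<beta> * v p) * R x p - \<alpha> * v q * R x q"
      unfolding sum_subtractf using pq by simp
    finally show ?thesis .
  qed
  have "eigenvalue (mat N N (\<lambda>(x, y). M x y
              - (if x = p \<and> y = p then \<beta> else 0) - (if x = q \<and> y = q then \<alpha> else 0))) t
      \<longleftrightarrow> (\<exists>v. (\<exists>x<N. v x \<noteq> 0) \<and> (\<forall>x<N. (\<Sum>y<N. T x y * v y) = rhs v x))"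
    unfolding eigenvalue_mat_iff
    by (intro ex_cong1 conj_cong refl all_cong) (simp only: pert rhs_def, auto)
  also have "\<dots> \<longleftrightarrow> (\<exists>v. (\<exists>x<N. v x \<noteq> 0)
      \<and> (\<forall>x<N. v x = - (\<beta> * v p) * R x p - \<alpha> * v q * R x q))"
  proof (intro ex_cong1 conj_cong refl)
    fix v :: "nat \<Rightarrow> real"
    have "(\<forall>x<N. (\<Sum>y<N. T x y * v y) = rhs v x) \<longleftrightarrow> (\<forall>x<N. v x = (\<Sum>z<N. R x z * rhs v z))"
    proof safe
      fix x assume *: "\<forall>x<N. (\<Sum>y<N. T x y * v y) = rhs v x" and x: "x < N"
      have "(\<Sum>z<N. R x z * rhs v z) = (\<Sum>z<N. \<Sum>y<N. R x z * (T z y * v y))"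
        using * by (simp add: sum_distrib_left[symmetric])
      also have "\<dots> = (\<Sum>y<N. (\<Sum>z<N. R x z * T z y) * v y)"
        by (subst sum.swap) (simp add: sum_distrib_right mult.assoc)
      also have "\<dots> = v x"
        using x by (simp add: RT if_distrib[of "\<lambda>c. c * _"] cong: if_cong)
      finally show "v x = (\<Sum>z<N. R x z * rhs v z)" by simp
    next
      fix x assume *: "\<forall>x<N. v x = (\<Sum>z<N. R x z * rhs v z)" and x: "x < N"
      have "(\<Sum>y<N. T x y * v y) = (\<Sum>y<N. \<Sum>z<N. T x y * (R y z * rhs v z))"
        unfolding sum_distrib_left[symmetric] using * by (intro sum.cong refl) auto
      also have "\<dots> = (\<Sum>z<N. (\<Sum>y<N. T x y * R y z) * rhs v z)"
        by (subst sum.swap) (simp add: sum_distrib_right mult.assoc)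
      also have "\<dots> = rhs v x"
        using x by (simp add: TR if_distrib[of "\<lambda>c. c * _"] cong: if_cong)
      finally show "(\<Sum>y<N. T x y * v y) = rhs v x" .
    qed
    then show "(\<forall>x<N. (\<Sum>y<N. T x y * v y) = rhs v x)
        \<longleftrightarrow> (\<forall>x<N. v x = - (\<beta> * v p) * R x p - \<alpha> * v q * R x q)"
      unfolding R_rhs .
  qed
  also have "\<dots> \<longleftrightarrow> (\<exists>v w. (v \<noteq> 0 \<or> w \<noteq> 0) \<and> (1 + \<beta> * R p p) * v + \<alpha> * R p q * w = 0
      \<and> \<beta> * R p q * v + (1 + \<alpha> * R q q) * w = 0)"
  proof (intro iffI; elim exE conjE)
    fix v :: "nat \<Rightarrow> real" and x
    assume x: "x < N" "v x \<noteq> 0" and *: "\<forall>x<N. v x = - (\<beta> * v p) * R x p - \<alpha> * v q * R x q"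
    have "v p \<noteq> 0 \<or> v q \<noteq> 0" using *[rule_format, OF x(1)] x(2) by auto
    moreover have "(1 + \<beta> * R p p) * v p + \<alpha> * R p q * v q = 0"
      using *[rule_format, OF pq(1)] by (simp add: algebra_simps)
    moreover have "\<beta> * R p q * v p + (1 + \<alpha> * R q q) * v q = 0"
      using *[rule_format, OF pq(2)] by (simp add: algebra_simps Rs)
    ultimately show "\<exists>v w. (v \<noteq> 0 \<or> w \<noteq> 0) \<and> (1 + \<beta> * R p p) * v + \<alpha> * R p q * w = 0
      \<and> \<beta> * R p q * v + (1 + \<alpha> * R q q) * w = 0" by blast
  next
    fix s w
    assume nz: "s \<noteq> 0 \<or> w \<noteq> (0::real)" and e: "(1 + \<beta> * R p p) * s + \<alpha> * R p q * w = 0"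
      "\<beta> * R p q * s + (1 + \<alpha> * R q q) * w = 0"
    define v where "v x = - (\<beta> * s) * R x p - \<alpha> * w * R x q" for x
    have v: "v p = s" "v q = w" using e by (simp_all add: v_def algebra_simps Rs)
    then show "\<exists>v. (\<exists>x<N. v x \<noteq> 0) \<and> (\<forall>x<N. v x = - (\<beta> * v p) * R x p - \<alpha> * v q * R x q)"
      using nz pq by (intro exI[of _ v]) (auto simp: v v_def)
  qed
  also have "\<dots> \<longleftrightarrow> (1 + \<alpha> * R q q) * (1 + \<beta> * R p p) - \<alpha> * \<beta> * (R p q)\<^sup>2 = 0"
    using two_by_two_singular[of "1 + \<beta> * R p p" "\<alpha> * R p q" "\<beta> * R p q" "1 + \<alpha> * R q q"]
    by (simp add: algebra_simps power2_eq_square)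
  finally show ?thesis .
qed

lemma two_point_quadratic_form:
  fixes v :: "nat \<Rightarrow> real"
  assumes "p < N" "q < N" "p \<noteq> q"
  shows "(\<Sum>x<N. \<Sum>y<N. v x * (A x y - (if x = p \<and> y = p then \<beta> else 0)
            - (if x = q \<and> y = q then \<alpha> else 0) - A x y) * v y) = - \<beta> * (v p)\<^sup>2 - \<alpha> * (v q)\<^sup>2"
proof -
  have "(\<Sum>x<N. \<Sum>y<N. v x * (A x y - (if x = p \<and> y = p then \<beta> else 0)
            - (if x = q \<and> y = q then \<alpha> else 0) - A x y) * v y)
      = (\<Sum>x<N. \<Sum>y<N. (if y = p then (if x = p then - \<beta> * (v p)\<^sup>2 else 0) else 0)
            - (if y = q then (if x = q then \<alpha> * (v q)\<^sup>2 else 0) else 0))"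
    by (intro sum.cong refl) (use assms in \<open>auto simp: power2_eq_square\<close>)
  also have "\<dots> = - \<beta> * (v p)\<^sup>2 - \<alpha> * (v q)\<^sup>2"
    unfolding sum_subtractf using assms by simp
  finally show ?thesis .
qed

text \<open>
  The 0 in the minimum and the maximum comes from the coordinates other than \<open>p\<close> and \<open>q\<close>.
\<close>

lemma two_point_quadratic_form_bounds:
  fixes v :: "nat \<Rightarrow> real" and \<alpha> \<beta> :: real
  assumes pq: "p < N" "q < N" "p \<noteq> q"
  shows "Min {0, - \<alpha>, - \<beta>} * (\<Sum>x<N. (v x)\<^sup>2) \<le> - \<beta> * (v p)\<^sup>2 - \<alpha> * (v q)\<^sup>2"
    and "- \<beta> * (v p)\<^sup>2 - \<alpha> * (v q)\<^sup>2 \<le> Max {0, - \<alpha>, - \<beta>} * (\<Sum>x<N. (v x)\<^sup>2)"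
proof -
  define S where "S = (\<Sum>x<N. (v x)\<^sup>2)"
  have "(\<Sum>x\<in>{p, q}. (v x)\<^sup>2) \<le> S" unfolding S_def by (rule sum_mono2) (use pq in auto)
  then have S: "(v p)\<^sup>2 + (v q)\<^sup>2 \<le> S" using pq by simp
  define l where "l = Min {0, - \<alpha>, - \<beta>}"
  define u where "u = Max {0, - \<alpha>, - \<beta>}"
  have l: "l \<le> 0" "l \<le> - \<alpha>" "l \<le> - \<beta>" and u: "0 \<le> u" "- \<alpha> \<le> u" "- \<beta> \<le> u"
    by (simp_all add: l_def u_def)
  have "l * S \<le> l * ((v p)\<^sup>2 + (v q)\<^sup>2)" using S l(1) by (rule mult_left_mono_neg)
  also have "\<dots> \<le> - \<beta> * (v p)\<^sup>2 - \<alpha> * (v q)\<^sup>2"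
    using mult_right_mono[OF l(3), of "(v p)\<^sup>2"] mult_right_mono[OF l(2), of "(v q)\<^sup>2"]
    by (simp add: distrib_left)
  finally show "Min {0, - \<alpha>, - \<beta>} * (\<Sum>x<N. (v x)\<^sup>2) \<le> - \<beta> * (v p)\<^sup>2 - \<alpha> * (v q)\<^sup>2"
    unfolding l_def S_def .
  have "- \<beta> * (v p)\<^sup>2 - \<alpha> * (v q)\<^sup>2 \<le> u * ((v p)\<^sup>2 + (v q)\<^sup>2)"
    using mult_right_mono[OF u(3), of "(v p)\<^sup>2"] mult_right_mono[OF u(2), of "(v q)\<^sup>2"]
    by (simp add: distrib_left)
  also have "\<dots> \<le> u * S" using S u(1) by (rule mult_left_mono)
  finally show "- \<beta> * (v p)\<^sup>2 - \<alpha> * (v q)\<^sup>2 \<le> Max {0, - \<alpha>, - \<beta>} * (\<Sum>x<N. (v x)\<^sup>2)"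
    unfolding u_def S_def .
qed

section \<open>Cosine sums over the roots of unity\<close>

text \<open>
  The argument of \<open>\<omega>\<close> to the power \<open>k s\<close>. The second index is an integer since differences of matrix
  indices occur.
\<close>

definition grid_angle :: "nat \<Rightarrow> nat \<Rightarrow> int \<Rightarrow> real" where
  "grid_angle n k s = 2 * pi * real k * of_int s / real (n + 2)"

lemma grid_angle_add: "grid_angle n k (s + t) = grid_angle n k s + grid_angle n k t"
  and grid_angle_diff: "grid_angle n k (s - t) = grid_angle n k s - grid_angle n k t"
  by (simp_all add: grid_angle_def distrib_left right_diff_distrib add_divide_distrib diff_divide_distrib)

text \<open>
  The frequencies \<open>k\<close> and \<open>N - k\<close> belong to conjugate roots of unity; this is why only half of
  them occur in the theorem.
\<close>

lemma grid_angle_reflect: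
  assumes "k \<le> n + 2"
  shows "cos (grid_angle n (n + 2 - k) s) = cos (grid_angle n k s)"
proof -
  have "grid_angle n (n + 2 - k) s = 2 * pi * of_int s - grid_angle n k s"
    using assms by (simp add: grid_angle_def of_nat_diff field_simps)
  then show ?thesis by (simp add: cos_diff)
qed

lemma grid_angle_middle:
  assumes "even n"
  shows "grid_angle n (n div 2 + 1) s = pi * of_int s"
proof -
  obtain j where "n = 2 * j" using assms by (elim evenE)
  then show ?thesis by (simp add: grid_angle_def field_simps)
qed

lemma grid_angle_last: "grid_angle n k (int (n + 1)) = 2 * pi * real k - grid_angle n k 1"
  by (simp add: grid_angle_def field_simps)

text \<open>
  The real part of a geometric sum whose ratio is an \<open>N\<close>-th root of unity. All the trigonometric
  identities needed below come down to this one.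
\<close>

lemma sum_cos_grid_angle:
  "(\<Sum>k<n + 2. cos (grid_angle n k s)) = (if int (n + 2) dvd s then real (n + 2) else 0)"
proof -
  define z where "z = cis (grid_angle n 1 s)"
  have "cis (grid_angle n k s) = z ^ k" for k
    by (simp add: z_def DeMoivre grid_angle_def mult_ac)
  then have "(\<Sum>k<n + 2. cos (grid_angle n k s)) = Re (\<Sum>k<n + 2. z ^ k)"
    by (simp only: Re_sum) (metis cis.sel(1))
  moreover have "z ^ (n + 2) = 1"
  proof -
    have "real (n + 2) * grid_angle n 1 s = 2 * pi * of_int s" by (simp add: grid_angle_def)
    then show ?thesis by (simp only: z_def DeMoivre) simp
  qed
  moreover have "z = 1 \<longleftrightarrow> int (n + 2) dvd s"
  proof
    assume "z = 1"
    then have "cos (grid_angle n 1 s) = 1" by (simp add: z_def complex_eq_iff)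
    then obtain r where r: "grid_angle n 1 s = of_int r * 2 * pi" by (auto simp: cos_one_2pi_int)
    then have "(2 * pi) * real_of_int s = (2 * pi) * real_of_int (int (n + 2) * r)"
      by (simp add: grid_angle_def field_simps)
    then have "real_of_int s = real_of_int (int (n + 2) * r)"
      by (simp only: mult_cancel_left) simp
    then have "s = int (n + 2) * r" by (simp only: of_int_eq_iff)
    then show "int (n + 2) dvd s" by simp
  next
    assume "int (n + 2) dvd s"
    then obtain r where "s = int (n + 2) * r" by (elim dvdE)
    then have "grid_angle n 1 s = 2 * pi * of_int r" by (simp add: grid_angle_def field_simps)
    then show "z = 1" by (simp add: z_def)
  qed
  ultimately show ?thesis by (simp add: sum_gp_strict del: sum.lessThan_Suc)
qed

text \<open>
  Pairing \<open>k\<close> with \<open>N - k\<close> leaves the fixed point 0 alone and, if \<open>N\<close> is even, the fixed point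
  \<open>N / 2\<close>. This is the only source of the distinction between odd and even \<open>n\<close>.
\<close>

lemma sum_reflection_fold:
  fixes g :: "nat \<Rightarrow> real"
  assumes refl: "\<And>k. k \<le> n + 2 \<Longrightarrow> g (n + 2 - k) = g k"
  shows "(\<Sum>k<n + 2. g k)
    = g 0 + (if even n then g (n div 2 + 1) else 0) + 2 * (\<Sum>k = 1..(n + 1) div 2. g k)"
proof -
  let ?m = "(n + 1) div 2"
  let ?I = "{1..?m}" and ?J = "{n + 2 - ?m..n + 1}" and ?K = "if even n then {n div 2 + 1} else {}"
  have split: "{..<n + 2} = insert 0 (?K \<union> (?I \<union> ?J))"
    by (auto elim!: evenE oddE)
  have "sum g ?J = sum g ?I"
    by (rule sum.reindex_bij_witness[of _ "\<lambda>k. n + 2 - k" "\<lambda>k. n + 2 - k"]) (auto simp: refl simp del: add_2_eq_Suc')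
  moreover have "sum g (insert 0 (?K \<union> (?I \<union> ?J))) = g 0 + (sum g ?K + (sum g ?I + sum g ?J))"
  proof -
    have "sum g (insert 0 (?K \<union> (?I \<union> ?J))) = g 0 + sum g (?K \<union> (?I \<union> ?J))"
      by (subst sum.insert) (auto elim!: evenE oddE)
    also have "sum g (?K \<union> (?I \<union> ?J)) = sum g ?K + sum g (?I \<union> ?J)"
      by (rule sum.union_disjoint) (auto elim!: evenE oddE)
    also have "sum g (?I \<union> ?J) = sum g ?I + sum g ?J"
      by (rule sum.union_disjoint) (auto elim!: evenE oddE)
    finally show ?thesis .
  qed
  ultimately show ?thesis unfolding split by simp
qed

text \<open>
  Since \<open>\<omega>\<^sup>N = 1\<close>, the exponents \<open>- n k\<close> and \<open>- (n + 1) k\<close> may be replaced by \<open>2 k\<close> and \<open>k\<close>.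
\<close>

lemma lam_eq_cis:
  "lam n a b c k = of_real b + of_real a * cis (grid_angle n k 2) + of_real c * cis (grid_angle n k 1)"
proof -
  have om: "omega n powi (- (int j * int k)) = cis (grid_angle n k (int (n + 2) - int j))" if "j \<le> n + 2" for j
  proof -
    have "omega n = cis (2 * pi / real (n + 2))"
      unfolding omega_def cis_conv_exp by (simp add: mult_ac)
    then have "omega n powi (- (int j * int k)) = cis (of_int (- (int j * int k)) * (2 * pi / real (n + 2)))"
      by (simp only: cis_power_int)
    also have "\<dots> = cis (2 * pi * real k) * cis (of_int (- (int j * int k)) * (2 * pi / real (n + 2)))"
      by simp
    also have "\<dots> = cis (grid_angle n k (int (n + 2) - int j))"
      unfolding cis_mult by (rule arg_cong[of _ _ cis]) (simp add: grid_angle_def field_simps)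
    finally show ?thesis .
  qed
  show ?thesis unfolding lam_def using om[of n] om[of "n + 1"] by simp
qed

text \<open>
  Multiplying by a root of unity shifts the three frequencies together. Summed over \<open>k\<close>, the right-hand
  side picks out the residues \<open>0\<close>, \<open>- 2\<close> and \<open>- 1\<close> of \<open>s\<close>, the positions of \<open>b\<close>, \<open>a\<close> and \<open>c\<close>.
\<close>

lemma Re_lam_cis:
  "Re (lam n a b c k * cis (grid_angle n k s))
     = b * cos (grid_angle n k s) + a * cos (grid_angle n k (s + 2)) + c * cos (grid_angle n k (s + 1))"
proof -
  have "lam n a b c k * cis (grid_angle n k s) = of_real b * cis (grid_angle n k s)
      + of_real a * cis (grid_angle n k (s + 2)) + of_real c * cis (grid_angle n k (s + 1))"
    unfolding lam_eq_cis grid_angle_add cis_mult[symmetric] by (simp add: algebra_simps)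
  then show ?thesis by simp
qed

section \<open>Diagonalisation of the cyclic completion\<close>

definition mode_angle :: "nat \<Rightarrow> real \<Rightarrow> real \<Rightarrow> real \<Rightarrow> nat \<Rightarrow> nat \<Rightarrow> real" where
  "mode_angle n a b c k x = theta n a b c k / 2 + grid_angle n k (int x)"

text \<open>
  Multiplying \<open>v\<^sub>k\<close> by \<open>cis (\<theta>\<^sub>k / 2)\<close> turns the factor in \<open>C v\<^sub>k = cnj \<lambda>\<^sub>k * cnj v\<^sub>k\<close> into
  \<open>|\<lambda>\<^sub>k|\<close>, so the cosine and the sine with this phase are eigenvectors. The alternating
  mode belongs to \<open>\<omega>\<^sup>k = - 1\<close>, which needs \<open>n\<close> even. In both parities the remaining frequencies
  are those up to \<open>(n + 1) div 2\<close>. The order of the list is that of the numbers \<open>d\<^sub>k\<close>.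
\<close>

definition circulant_modes :: "nat \<Rightarrow> real \<Rightarrow> real \<Rightarrow> real \<Rightarrow> (real \<times> (nat \<Rightarrow> real)) list" where
  "circulant_modes n a b c =
     (Re (lam n a b c 0), \<lambda>_. 1 / sqrt (real (n + 2)))
     # (if even n then [(Re (lam n a b c (n div 2 + 1)), \<lambda>x. (- 1) ^ x / sqrt (real (n + 2)))] else [])
     @ map (\<lambda>k. (cmod (lam n a b c k), \<lambda>x. sqrt (2 / real (n + 2)) * cos (mode_angle n a b c k x)))
         [1..<(n + 1) div 2 + 1]
     @ map (\<lambda>k. (- cmod (lam n a b c k), \<lambda>x. sqrt (2 / real (n + 2)) * sin (mode_angle n a b c k x)))
         [1..<(n + 1) div 2 + 1]"

lemma circulant_modes_eigenvalues:
  "odd n \<Longrightarrow> map fst (circulant_modes n a b c) = d_odd n a b c"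
  "even n \<Longrightarrow> map fst (circulant_modes n a b c) = d_even n a b c"
  by (auto simp: circulant_modes_def d_odd_def d_even_def elim!: evenE)

lemma length_circulant_modes: "length (circulant_modes n a b c) = n + 2"
  by (auto simp: circulant_modes_def elim!: evenE oddE)

lemma fcalc_circulant_modes:
  "fcalc f (circulant_modes n a b c) x y =
     (f (Re (lam n a b c 0))
       + (if even n then f (Re (lam n a b c (n div 2 + 1))) * (- 1) ^ (x + y) else 0)
       + 2 * (\<Sum>k = 1..(n + 1) div 2.
           f (cmod (lam n a b c k)) * (cos (mode_angle n a b c k x) * cos (mode_angle n a b c k y))
         + f (- cmod (lam n a b c k)) * (sin (mode_angle n a b c k x) * sin (mode_angle n a b c k y))))
     / real (n + 2)"
proof -
  define N where "N = real (n + 2)"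
  have N: "N > 0" by (simp add: N_def)
  then have sq: "sqrt N * sqrt N = N" "sqrt (2 / N) * sqrt (2 / N) = 2 / N" by simp_all
  have sq': "sqrt (2 / N) * u * (sqrt (2 / N) * v) = 2 / N * (u * v)" for u v
  proof -
    have "sqrt (2 / N) * u * (sqrt (2 / N) * v) = sqrt (2 / N) * sqrt (2 / N) * (u * v)"
      by (simp only: mult_ac)
    then show ?thesis by (simp only: sq(2))
  qed
  have upt: "(\<Sum>k\<leftarrow>[1..<(n + 1) div 2 + 1]. g k) = (\<Sum>k = 1..(n + 1) div 2. g k)" for g :: "nat \<Rightarrow> real"
    by (simp only: interv_sum_list_conv_sum_set_nat set_upt) (simp add: atLeastLessThanSuc_atLeastAtMost)
  have sum: "(\<Sum>k\<leftarrow>[1..<(n + 1) div 2 + 1]. f (g k) * (sqrt (2 / N) * u k * (sqrt (2 / N) * v k)))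
      = 2 * (\<Sum>k = 1..(n + 1) div 2. f (g k) * (u k * v k)) / N" for g u v
    unfolding upt sq' sum_distrib_left sum_divide_distrib by (intro sum.cong refl) simp
  let ?u = "mode_angle n a b c" and ?l = "lam n a b c"
  have "fcalc f (circulant_modes n a b c) x y =
      f (Re (?l 0)) * (1 / sqrt N * (1 / sqrt N))
      + (if even n then f (Re (?l (n div 2 + 1))) * ((- 1) ^ x / sqrt N * ((- 1) ^ y / sqrt N)) else 0)
      + (\<Sum>k\<leftarrow>[1..<(n + 1) div 2 + 1]. f (cmod (?l k))
          * (sqrt (2 / N) * cos (?u k x) * (sqrt (2 / N) * cos (?u k y))))
      + (\<Sum>k\<leftarrow>[1..<(n + 1) div 2 + 1]. f (- cmod (?l k))
          * (sqrt (2 / N) * sin (?u k x) * (sqrt (2 / N) * sin (?u k y))))"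
    unfolding fcalc_def circulant_modes_def N_def[symmetric]
    by (cases "even n") (simp_all only: if_True if_False list.map map_append map_map o_def sum_list.Cons
        sum_list.Nil sum_list.append fst_conv snd_conv append.simps add_0_right add.assoc add_0_left)
  also have "\<dots> = f (Re (?l 0)) / N
      + (if even n then f (Re (?l (n div 2 + 1))) * (- 1) ^ (x + y) / N else 0)
      + 2 * (\<Sum>k = 1..(n + 1) div 2. f (cmod (?l k)) * (cos (?u k x) * cos (?u k y))) / N
      + 2 * (\<Sum>k = 1..(n + 1) div 2. f (- cmod (?l k)) * (sin (?u k x) * sin (?u k y))) / N"
    unfolding sum using N by (simp add: power_add)
  finally show ?thesis
    unfolding N_def[symmetric] by (simp add: sum.distrib add_divide_distrib distrib_left)
qed

definition wrapped_hankel :: "nat \<Rightarrow> real \<Rightarrow> real \<Rightarrow> real \<Rightarrow> int \<Rightarrow> real" where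
  "wrapped_hankel n a b c s = (if int (n + 2) dvd s then b else 0)
     + (if int (n + 2) dvd s + 2 then a else 0) + (if int (n + 2) dvd s + 1 then c else 0)"

text \<open>
  For each frequency the cosine and sine terms combine by the addition theorems: to
  \<open>cos (2 \<pi> k (x - y) / N)\<close> with weights \<open>1, 1\<close>, and to \<open>Re (\<lambda>\<^sub>k \<omega>\<^sup>k\<^sup>(\<^sup>x\<^sup>+\<^sup>y\<^sup>))\<close> with weights
  \<open>|\<lambda>\<^sub>k|, - |\<lambda>\<^sub>k|\<close>. Unfolding the pairs of conjugate frequencies gives full sums over the roots of
  unity.
\<close>

lemma spectral_resolution_circulant:
  "spectral_resolution (n + 2) (\<lambda>x y. wrapped_hankel n a b c (int x + int y)) (circulant_modes n a b c)"
proof -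
  have "fcalc (\<lambda>_. 1) (circulant_modes n a b c) x y = (if x = y then 1 else 0)"
    if xy: "x < n + 2" "y < n + 2" for x y
  proof -
    define g where "g k = cos (grid_angle n k (int x - int y))" for k
    have reflect: "g (n + 2 - k) = g k" if "k \<le> n + 2" for k
      unfolding g_def by (rule grid_angle_reflect[OF that])
    have mid: "(- 1) ^ (x + y) = g (n div 2 + 1)" if "even n"
    proof -
      have "g (n div 2 + 1) = cos (real x * pi - real y * pi)"
        unfolding g_def grid_angle_middle[OF that] by (simp add: algebra_simps)
      then show ?thesis by (simp add: cos_diff power_add)
    qed
    have "cos (mode_angle n a b c k x) * cos (mode_angle n a b c k y)
        + sin (mode_angle n a b c k x) * sin (mode_angle n a b c k y) = g k" for k
      unfolding cos_diff[symmetric] g_def by (simp add: mode_angle_def grid_angle_diff)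
    then have "fcalc (\<lambda>_. 1) (circulant_modes n a b c) x y
        = (g 0 + (if even n then g (n div 2 + 1) else 0) + 2 * (\<Sum>k = 1..(n + 1) div 2. g k)) / real (n + 2)"
      unfolding fcalc_circulant_modes using mid by (simp add: g_def[of 0] grid_angle_def[of _ 0])
    also have "\<dots> = (\<Sum>k<n + 2. g k) / real (n + 2)"
      by (simp only: sum_reflection_fold[of n g, OF reflect])
    also have "\<dots> = (if int (n + 2) dvd int x - int y then 1 else 0)"
      unfolding g_def sum_cos_grid_angle by simp
    also have "int (n + 2) dvd int x - int y \<longleftrightarrow> x = y"
    proof
      assume d: "int (n + 2) dvd int x - int y"
      show "x = y"
      proof (rule ccontr)
        assume "x \<noteq> y"
        then have "int (n + 2) \<le> \<bar>int x - int y\<bar>" using d by (intro zdvd_imp_le) (simp_all)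
        then show False using xy by linarith
      qed
    qed simp
    finally show ?thesis .
  qed
  moreover have "fcalc (\<lambda>d. d) (circulant_modes n a b c) x y = wrapped_hankel n a b c (int x + int y)" for x y
  proof -
    define s where "s = int x + int y"
    define g where "g k = Re (lam n a b c k * cis (grid_angle n k s))" for k
    have reflect: "g (n + 2 - k) = g k" if "k \<le> n + 2" for k
      unfolding g_def Re_lam_cis grid_angle_reflect[OF that] by (rule refl)
    have mid: "Re (lam n a b c (n div 2 + 1)) * (- 1) ^ (x + y) = g (n div 2 + 1)" if "even n"
    proof -
      have "cis (grid_angle n (n div 2 + 1) s) = cis (real (x + y) * pi)"
        unfolding grid_angle_middle[OF that] by (simp add: s_def mult.commute)
      also have "\<dots> = (- 1) ^ (x + y)" by (simp only: DeMoivre[symmetric] cis_pi)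
      finally show ?thesis by (simp add: g_def)
    qed
    have pair: "cmod (lam n a b c k) * (cos (mode_angle n a b c k x) * cos (mode_angle n a b c k y))
        + - cmod (lam n a b c k) * (sin (mode_angle n a b c k x) * sin (mode_angle n a b c k y)) = g k" for k
    proof -
      have "g k = Re (rcis (cmod (lam n a b c k)) (theta n a b c k) * cis (grid_angle n k s))"
        unfolding g_def theta_def rcis_cmod_Arg by (rule refl)
      also have "\<dots> = cmod (lam n a b c k) * cos (theta n a b c k + grid_angle n k s)"
        by (simp add: rcis_def cis_mult mult.assoc)
      also have "theta n a b c k + grid_angle n k s = mode_angle n a b c k x + mode_angle n a b c k y"
        by (simp add: mode_angle_def s_def grid_angle_add)
      finally show ?thesis by (simp add: cos_add right_diff_distrib)
    qed
    have "fcalc (\<lambda>d. d) (circulant_modes n a b c) x y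
        = (g 0 + (if even n then g (n div 2 + 1) else 0) + 2 * (\<Sum>k = 1..(n + 1) div 2. g k)) / real (n + 2)"
      unfolding fcalc_circulant_modes pair using mid by (simp add: g_def[of 0] grid_angle_def[of _ 0])
    also have "\<dots> = (\<Sum>k<n + 2. g k) / real (n + 2)"
      by (simp only: sum_reflection_fold[of n g, OF reflect])
    also have "\<dots> = wrapped_hankel n a b c s"
      unfolding g_def Re_lam_cis sum.distrib sum_distrib_left[symmetric] sum_cos_grid_angle
      by (simp add: wrapped_hankel_def add_divide_distrib)
    finally show ?thesis by (simp add: s_def)
  qed
  ultimately show ?thesis
    by (simp add: spectral_resolution_def length_circulant_modes)
qed

lemma mode_angle_first:
  "mode_angle n a b c k 0 = theta n a b c k / 2"
  by (simp add: mode_angle_def grid_angle_def)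

text \<open>
  The last index \<open>N - 1\<close> is \<open>- 1\<close> modulo \<open>N\<close>; hence the parameter \<open>2 \<pi> / N\<close> of \<open>F\<close> and \<open>G\<close>.
\<close>

lemma mode_angle_last:
  "cos (mode_angle n a b c k (n + 1)) = cos (theta n a b c k / 2 - 2 * pi / (real n + 2) * real k)"
  "sin (mode_angle n a b c k (n + 1)) = sin (theta n a b c k / 2 - 2 * pi / (real n + 2) * real k)"
proof -
  have "mode_angle n a b c k (n + 1)
      = (theta n a b c k / 2 - 2 * pi / (real n + 2) * real k) + 2 * pi * real_of_int (int k)"
    unfolding mode_angle_def grid_angle_last by (simp add: grid_angle_def)
  then show "cos (mode_angle n a b c k (n + 1)) = cos (theta n a b c k / 2 - 2 * pi / (real n + 2) * real k)"
    "sin (mode_angle n a b c k (n + 1)) = sin (theta n a b c k / 2 - 2 * pi / (real n + 2) * real k)"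
    by (simp_all only: cos_add sin_add cos_int_2pin sin_int_2pin mult_1_right mult_zero_right diff_zero add_0_right)
qed

lemma resolvent_odd:
  fixes a b c :: real
  assumes "odd n"
  defines "R \<equiv> \<lambda>t. fcalc (\<lambda>d. 1 / (t - d)) (circulant_modes n a b c)"
    and "p \<equiv> 2 * pi / (real n + 2)" and "m \<equiv> (n + 1) div 2"
  shows "R t 0 0 = F n a b c m t 0 0 / (real n + 2)"
    and "R t (n + 1) (n + 1) = F n a b c m t p p / (real n + 2)"
    and "R t 0 (n + 1) = F n a b c m t 0 p / (real n + 2)"
  using assms(1) unfolding R_def fcalc_circulant_modes mode_angle_first mode_angle_last F_def p_def m_def
  by (simp_all add: add.commute)

text \<open>
  The alternating mode has the values 1 and \<open>- 1\<close> at the two ends. So its contribution to the mixed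
  entry has the opposite sign to the one in \<open>G\<close>, which accounts for the correction term.
\<close>

lemma resolvent_even:
  fixes a b c :: real
  assumes "even n"
  defines "R \<equiv> \<lambda>t. fcalc (\<lambda>d. 1 / (t - d)) (circulant_modes n a b c)"
    and "p \<equiv> 2 * pi / (real n + 2)" and "m \<equiv> n div 2"
  shows "R t 0 0 = G n a b c m t 0 0 / (real n + 2)"
    and "R t (n + 1) (n + 1) = G n a b c m t p p / (real n + 2)"
    and "R t 0 (n + 1) = (G n a b c m t 0 p - 2 / (t - Re (lam n a b c (m + 1)))) / (real n + 2)"
proof -
  have m: "(n + 1) div 2 = n div 2" and e: "even n" using assms(1) by auto
  have s: "(- 1) ^ (0 + 0) = (1::real)" "(- 1) ^ (n + 1 + (n + 1)) = (1::real)" "(- 1) ^ (0 + (n + 1)) = (- 1::real)"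
    using e by simp_all
  show "R t 0 0 = G n a b c m t 0 0 / (real n + 2)"
    and "R t (n + 1) (n + 1) = G n a b c m t p p / (real n + 2)"
    unfolding R_def fcalc_circulant_modes mode_angle_first mode_angle_last G_def p_def m_def m s
    using e by (simp_all add: add.commute)
  show "R t 0 (n + 1) = (G n a b c m t 0 p - 2 / (t - Re (lam n a b c (m + 1)))) / (real n + 2)"
    unfolding R_def fcalc_circulant_modes mode_angle_first mode_angle_last G_def p_def m_def m s
    using e by (simp add: add.commute)
qed

section \<open>Eigenvalues of the Hankel matrix\<close>

text \<open>
  As \<open>0 \<le> x + y \<le> 2 N - 2\<close>, a residue class is hit outside the three diagonals only by \<open>x + y = 0\<close>,
  which wraps onto the diagonal of \<open>b\<close>, and by \<open>x + y = 2 N - 2\<close>, which wraps onto that of \<open>a\<close>.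
\<close>

lemma hankel_eq_wrapped:
  assumes n: "n \<ge> 1"
  shows "hankel n a b c = mat (n + 2) (n + 2) (\<lambda>(x, y). wrapped_hankel n a b c (int x + int y)
      - (if x = 0 \<and> y = 0 then b else 0) - (if x = n + 1 \<and> y = n + 1 then a else 0))"
proof -
  have dvd: "int (n + 2) dvd r \<longleftrightarrow> r = 0 \<or> r = int (n + 2) \<or> r = 2 * int (n + 2)"
    if "0 \<le> r" "r \<le> 2 * int (n + 2)" for r
  proof
    assume "int (n + 2) dvd r"
    then obtain q where q: "r = int (n + 2) * q" by (elim dvdE)
    have "0 \<le> q" using that(1) q by (simp add: zero_le_mult_iff)
    moreover have "int (n + 2) * q \<le> int (n + 2) * 2" using that(2) q by simp
    then have "q \<le> 2" by (subst (asm) mult_le_cancel_left_pos) auto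
    ultimately have "q \<in> {0, 1, 2}" by auto
    then show "r = 0 \<or> r = int (n + 2) \<or> r = 2 * int (n + 2)" using q by auto
  next
    assume "r = 0 \<or> r = int (n + 2) \<or> r = 2 * int (n + 2)"
    then show "int (n + 2) dvd r"
      by (elim disjE) (simp_all only: dvd_0_right dvd_refl dvd_triv_right)
  qed
  show ?thesis
    unfolding hankel_def
  proof (rule cong_mat[OF refl refl], clarify)
    fix x y assume "x < n + 2" "y < n + 2"
    then show "(if Suc x + Suc y = n + 2 then a else if Suc x + Suc y = n + 3 then c
         else if Suc x + Suc y = n + 4 then b else 0)
      = wrapped_hankel n a b c (int x + int y)
        - (if x = 0 \<and> y = 0 then b else 0) - (if x = n + 1 \<and> y = n + 1 then a else 0)"
      unfolding wrapped_hankel_def using n by (subst (1 2 3) dvd) (auto split: if_splits)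
  qed
qed

lemma hankel_eigenvalue_bounds:
  fixes a b c :: real
  assumes n: "n \<ge> 1"
  defines "\<mu> \<equiv> eigenvalue_list (hankel n a b c)" and "ds \<equiv> sort (map fst (circulant_modes n a b c))"
  shows "length \<mu> = n + 2"
    and "k < n + 2 \<Longrightarrow> ds ! k + Min {0, - a, - b} \<le> \<mu> ! k"
    and "k < n + 2 \<Longrightarrow> \<mu> ! k \<le> ds ! k + Max {0, - a, - b}"
proof -
  let ?W = "\<lambda>x y. wrapped_hankel n a b c (int x + int y)"
  define B where "B x y = ?W x y - (if x = 0 \<and> y = 0 then b else 0)
    - (if x = n + 1 \<and> y = n + 1 then a else 0)" for x y
  have sym: "B x y = B y x" for x y by (auto simp: B_def add.commute)
  have q: "(\<Sum>x<n + 2. \<Sum>y<n + 2. v x * (B x y - ?W x y) * v y) = - b * (v 0)\<^sup>2 - a * (v (n + 1))\<^sup>2"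
    for v unfolding B_def by (rule two_point_quadratic_form) auto
  have mu: "\<mu> = eigenvalue_list (mat (n + 2) (n + 2) (\<lambda>(x, y). B x y))"
    unfolding \<mu>_def B_def hankel_eq_wrapped[OF n] by (rule refl)
  have lower: "Min {0, - a, - b} * (\<Sum>x<n + 2. (v x)\<^sup>2)
      \<le> (\<Sum>x<n + 2. \<Sum>y<n + 2. v x * (B x y - ?W x y) * v y)"
    and upper: "(\<Sum>x<n + 2. \<Sum>y<n + 2. v x * (B x y - ?W x y) * v y)
      \<le> Max {0, - a, - b} * (\<Sum>x<n + 2. (v x)\<^sup>2)" for v
    unfolding q by (rule two_point_quadratic_form_bounds; simp)+
  note weyl = weyl_inequalities[OF spectral_resolution_circulant sym lower upper, folded mu ds_def]
  show "length \<mu> = n + 2" by (rule weyl(1))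
  show "k < n + 2 \<Longrightarrow> ds ! k + Min {0, - a, - b} \<le> \<mu> ! k" by (rule weyl(2))
  show "k < n + 2 \<Longrightarrow> \<mu> ! k \<le> ds ! k + Max {0, - a, - b}" by (rule weyl(3))
qed

lemma hankel_secular_equation:
  fixes a b c :: real
  assumes n: "n \<ge> 1" and t: "t \<notin> set (map fst (circulant_modes n a b c))"
  defines "R \<equiv> fcalc (\<lambda>d. 1 / (t - d)) (circulant_modes n a b c)"
  shows "eigenvalue (hankel n a b c) t
    \<longleftrightarrow> (1 + a * R (n + 1) (n + 1)) * (1 + b * R 0 0) - a * b * (R 0 (n + 1))\<^sup>2 = 0"
  unfolding hankel_eq_wrapped[OF n] R_def
  by (rule secular_equation[OF spectral_resolution_circulant]) (use t in auto)

theorem theorem1: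
  fixes n :: nat and a b c :: real
  assumes "n \<ge> 1"
  shows
    "(odd n \<longrightarrow>
        {t. eigenvalue (hankel n a b c) t \<and> t \<notin> set (d_odd n a b c)}
          = {t. t \<notin> set (d_odd n a b c) \<and> f_odd n a b c t = 0}
      \<and> length (eigenvalue_list (hankel n a b c)) = n + 2
      \<and> length (d_odd n a b c) = n + 2
      \<and> (\<forall>k\<in>{1..n + 2}.
          sort (d_odd n a b c) ! (k - 1) + Min {0, - a, - b}
            \<le> eigenvalue_list (hankel n a b c) ! (k - 1)
          \<and> eigenvalue_list (hankel n a b c) ! (k - 1)
            \<le> sort (d_odd n a b c) ! (k - 1) + Max {0, - a, - b}))
   \<and> (even n \<longrightarrow>
        {t. eigenvalue (hankel n a b c) t \<and> t \<notin> set (d_even n a b c)}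
          = {t. t \<notin> set (d_even n a b c) \<and> g_even n a b c t = 0}
      \<and> length (eigenvalue_list (hankel n a b c)) = n + 2
      \<and> length (d_even n a b c) = n + 2
      \<and> (\<forall>k\<in>{1..n + 2}.
          sort (d_even n a b c) ! (k - 1) + Min {0, - a, - b}
            \<le> eigenvalue_list (hankel n a b c) ! (k - 1)
          \<and> eigenvalue_list (hankel n a b c) ! (k - 1)
            \<le> sort (d_even n a b c) ! (k - 1) + Max {0, - a, - b}))"
proof -
  define ds where "ds = map fst (circulant_modes n a b c)"
  have len: "length ds = n + 2" by (simp add: ds_def length_circulant_modes)
  have expand: "(1 + a * (P / N)) * (1 + b * (Q / N)) - a * b * (S / N)\<^sup>2
      = 1 + a / N * P + b / N * Q + a * b / N\<^sup>2 * P * Q - a * b / N\<^sup>2 * S\<^sup>2" for N P Q S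
    by (simp add: algebra_simps power2_eq_square)
  have bounds: "\<forall>k\<in>{1..n + 2}.
          sort ds ! (k - 1) + Min {0, - a, - b} \<le> eigenvalue_list (hankel n a b c) ! (k - 1)
          \<and> eigenvalue_list (hankel n a b c) ! (k - 1) \<le> sort ds ! (k - 1) + Max {0, - a, - b}"
    unfolding ds_def
  proof
    fix k assume "k \<in> {1..n + 2}"
    then have "k - 1 < n + 2" by auto
    then show "sort (map fst (circulant_modes n a b c)) ! (k - 1) + Min {0, - a, - b}
            \<le> eigenvalue_list (hankel n a b c) ! (k - 1)
          \<and> eigenvalue_list (hankel n a b c) ! (k - 1)
            \<le> sort (map fst (circulant_modes n a b c)) ! (k - 1) + Max {0, - a, - b}"
      using hankel_eigenvalue_bounds(2,3)[OF assms] by blast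
  qed
  have "eigenvalue (hankel n a b c) t \<longleftrightarrow> f_odd n a b c t = 0" if "odd n" "t \<notin> set ds" for t
    using hankel_secular_equation[OF assms that(2)[unfolded ds_def]]
    unfolding resolvent_odd[OF that(1)] expand f_odd_def Let_def by simp
  moreover have "eigenvalue (hankel n a b c) t \<longleftrightarrow> g_even n a b c t = 0" if "even n" "t \<notin> set ds" for t
    using hankel_secular_equation[OF assms that(2)[unfolded ds_def]]
    unfolding resolvent_even[OF that(1)] expand g_even_def Let_def by simp
  moreover have "odd n \<Longrightarrow> ds = d_odd n a b c" "even n \<Longrightarrow> ds = d_even n a b c"
    by (simp_all add: ds_def circulant_modes_eigenvalues)
  ultimately show ?thesis
    using bounds len hankel_eigenvalue_bounds(1)[OF assms, of a b c] by auto
qed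

end
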